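(* Let $p$ be an odd prime and $n\ge4$ an integer with base-$p$ expansion $n=n_0+n_1p+\cdots+n_kp^k$, $n_j\in\{0,\ldots,p-1\}$, $n_k>0$. For a pseudo-composition $\gamma=(\gamma_1,\ldots,\gamma_\ell)$ of $n$ write $\gamma_i=\sum_{j=0}^k\gamma_{ij}p^j$ with digits $\gamma_{ij}\in\{0,\ldots,p-1\}$. For each pseudo-composition $\beta=(\beta_1,\ldots,\beta_\ell)$ of $n$ define $\beta'$ and $\nu_p(\beta')\in\mathbb{Z}_p$ by: - if $\beta_1=0$: $\beta':=\beta$ and $\nu_p(\beta'):=\tfrac12\prod_{j=0}^k2^{n_j}\binom{n_j}{\beta'_{1j},\ldots,\beta'_{\ell j}}$ (with $\tfrac12$ the inverse of $2$ modulo $p$); - if $\beta_1=1$: $\beta':=(0,1+\beta_2,\beta_3,\ldots,\beta_\ell)$ and $\nu_p(\beta')$ is defined by the same formula as in the case $\beta_1=0$ applied to $\beta'$; - if $\beta_1>1$: $\beta':=\beta$ and $\nu_p(\beta'):=\prod_{j=0}^k2^{n_j-\beta'_{1j}}\binom{n_j}{\beta'_{1j},\ldots,\beta'_{\ell j}}$. Let \[ P:=\bigl(\{b_0+b_1p+\cdots+b_kp^k: 0\le b_j\le n_j\}\cup\{1\}\bigr)\setminus\{n\}\subseteq\{0,1,\ldots,n-1\}, \] and for $T\subseteq P$ let \[ r^D(T):=\sum_{\substack{\beta\models_0 n,\ D(\beta)\subseteq T\\ \beta'_{1j}+\cdots+\beta'_{\ell' j}=n_j\ \forall j}}(-1)^{|T|-|D(\beta)|}\nu_p(\beta'),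 \] where $\ell'$ is the length of $\beta'$. Then $|P|=\prod_{j=0}^k(n_j+1)$ if $n_0=0$ and $|P|=\prod_{j=0}^k(n_j+1)-1$ if $n_0>0$, and for every $i\in\mathbb{Z}_p$, \[ c^D_{p,i}(n)=\begin{cases} 2^{\,n-|P|}\,|\{T\subseteq P: r^D(T)\equiv i\pmod p\}| & \text{if } i=0\text{ or } n_0=\cdots=n_{k-1}=p-1,\\ 2^{\,n-|P|-1}\,|\{T\subseteq P: r^D(T)\equiv i\text{ or } r^D(T)\equiv -i\pmod p\}| & \text{otherwise.}\end{cases} \]
   Context: A signed permutation of $[n]$ is a bijection $w$ of $\{\pm1,\ldots,\pm n\}$ with $w(-i)=-w(i)$; it is even if an even number of $w(1),\ldots,w(n)$ are negative; these form $\mathfrak{S}^D_n$. With the convention $w(0):=-w(2)$, $D(w)=\{i\in\{0,\ldots,n-1\}: w(i)>w(i+1)\}$. A pseudo-composition of $n$ ($\alpha\models_0 n$) is a sequence $(\alpha_1,\ldots,\alpha_\ell)$ of integers with $\alpha_1\ge0$, $\alpha_2,\ldots,\alpha_\ell>0$ and sum $n$, with $D(\alpha)=\{\alpha_1,\alpha_1+\alpha_2,\ldots,\alpha_1+\cdots+\alpha_{\ell-1}\}$. The type $D$ ribbon number is $r^D_\alpha=|\{w\in\mathfrak{S}^D_n: D(w)=D(\alpha)\}|$ and $c^D_{p,i}(n)=|\{\alpha\models_0 n: r^D_\alpha\equiv i\pmod p\}|$. Multinomial coefficients $\binom{m}{m_1,\ldots,m_k}$ equal $m!/(m_1!\cdots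 m_k!)$ if $\sum m_i=m$ and $0$ otherwise. *)

theory Defs
  imports Complex_Main "HOL-Number_Theory.Cong"
begin

(* Signed permutations of [n]: represented by their values w 1, ..., w n (w i = 0 outside {1..n});
   w(-i) = -w(i) is then implicit. *)
definition signed_perms :: "nat \<Rightarrow> (nat \<Rightarrow> int) set" where
  "signed_perms n = {w. (\<forall>i. i \<notin> {1..n} \<longrightarrow> w i = 0) \<and>
                        bij_betw (\<lambda>i. nat \<bar>w i\<bar>) {1..n} {1..n}}"

definition even_signed_perms :: "nat \<Rightarrow> (nat \<Rightarrow> int) set" where
  "even_signed_perms n = {w \<in> signed_perms n. even (card {i \<in> {1..n}. w i < 0})}"

definition wext :: "(nat \<Rightarrow> int) \<Rightarrow> nat \<Rightarrow> int" where
  "wext w i = (if i = 0 then - w 2 else w i)"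

definition descD :: "nat \<Rightarrow> (nat \<Rightarrow> int) \<Rightarrow> nat set" where
  "descD n w = {i \<in> {0..<n}. wext w i > wext w (i + 1)}"

definition pcomps :: "nat \<Rightarrow> nat list set" where
  "pcomps n = {a. a \<noteq> [] \<and> (\<forall>x \<in> set (tl a). x > 0) \<and> sum_list a = n}"

definition pdesc :: "nat list \<Rightarrow> nat set" where
  "pdesc a = {sum_list (take j a) | j. 1 \<le> j \<and> j < length a}"

definition ribbonD :: "nat \<Rightarrow> nat list \<Rightarrow> nat" where
  "ribbonD n a = card {w \<in> even_signed_perms n. descD n w = pdesc a}"

definition cD :: "nat \<Rightarrow> int \<Rightarrow> nat \<Rightarrow> nat" where
  "cD p i n = card {a \<in> pcomps n. [int (ribbonD n a) = i] (mod int p)}"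

definition digit :: "nat \<Rightarrow> nat \<Rightarrow> nat \<Rightarrow> nat" where
  "digit p j m = m div p ^ j mod p"

definition multinom :: "nat \<Rightarrow> nat list \<Rightarrow> nat" where
  "multinom m ms = (if sum_list ms = m then fact m div prod_list (map fact ms) else 0)"

definition bprime :: "nat list \<Rightarrow> nat list" where
  "bprime b = (case b of Suc 0 # c # rest \<Rightarrow> 0 # Suc c # rest | _ \<Rightarrow> b)"

(* nu_p(beta') as an integer representative of the residue mod p;
   (p+1) div 2 is the inverse of 2 modulo the odd prime p *)
definition nuD :: "nat \<Rightarrow> nat \<Rightarrow> nat \<Rightarrow> nat list \<Rightarrow> int" where
  "nuD p n k b = (let b' = bprime b in
     if hd b \<le> 1 then
       int ((p + 1) div 2) *
         (\<Prod>j\<le>k. 2 ^ digit p j n * int (multinom (digit p j n) (map (digit p j) b')))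
     else
       (\<Prod>j\<le>k. 2 ^ (digit p j n - digit p j (hd b')) *
                  int (multinom (digit p j n) (map (digit p j) b'))))"

definition Pset :: "nat \<Rightarrow> nat \<Rightarrow> nat \<Rightarrow> nat set" where
  "Pset p n k = ({\<Sum>j\<le>k. bb j * p ^ j | bb. \<forall>j\<le>k. bb j \<le> digit p j n} \<union> {1}) - {n}"

definition rD :: "nat \<Rightarrow> nat \<Rightarrow> nat \<Rightarrow> nat set \<Rightarrow> int" where
  "rD p n k T = (\<Sum>b \<in> {b \<in> pcomps n. pdesc b \<subseteq> T \<and>
        (\<forall>j\<le>k. sum_list (map (digit p j) (bprime b)) = digit p j n)}.
      (-1) ^ (card T - card (pdesc b)) * nuD p n k b)"

end

(*
Exactly half of the signed permutations with a given type D descent set are even, because negating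
the entry of absolute value 1 flips the parity and preserves all comparisons. Hence the number of
even ones with descent set contained in D(beta) is |D_n| / |W_J|, where W_J is the parabolic
subgroup of the simple reflections outside D(beta); this is a power of 2 times a multinomial
coefficient; the diagram automorphism w(1) |-> -w(1) is the reason for beta' when beta_1 = 1.
By the theorems of Lucas and Fermat this number is nu_p(beta') modulo p, and it vanishes unless
adding up the parts of beta' involves no carries, which forces D(beta) to be a subset of P.
Moebius inversion then gives r_alpha = (-1)^|D(alpha) - P| r(D(alpha) \<inter> P) modulo p, so the elements
of {0, ..., n-1} - P only contribute a sign, which is equidistributed unless this set is empty.
*)

theory Submission
  imports Defs "HOL-Number_Theory.Residues"
begin

text \<open>No Coxeter group appears below: signed permutations are handled in one-line notation,
  cut into increasing blocks at \<open>D(beta)\<close>, and counted by removing the last block. Only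
  position 0 resists. Its comparison of \<open>- w 2\<close> with \<open>w 1\<close> is harmless if
  both entries lie in the first block (\<open>beta_1 > 1\<close>, where it leaves exactly one free
  sign) or if 0 is an allowed descent (\<open>beta_1 = 0\<close>), but it ties the first two blocks
  together if \<open>beta_1 = 1\<close>. That case is therefore exchanged for
  \<open>beta_1 = 0\<close> before any counting. Both sign changes in use, that of
  \<open>w 1\<close> and that of the entry of absolute value 1, reverse the parity. So the counting
  takes place among all signed permutations and is halved afterwards. The halving is the factor 1/2
  of \<open>nu_p\<close> for \<open>beta_1 <= 1\<close>; for \<open>beta_1 > 1\<close> it cancels
  against the free sign. Passing from \<open>D(beta')\<close> back to \<open>D(beta)\<close> can
  trade 0 for 1, which is why 1 is adjoined to \<open>P\<close>.\<close>

section \<open>Multinomial coefficients modulo a prime\<close>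

text \<open>This is (1+x)^(p+N) = (1+x^p)(1+x)^N modulo \<open>p\<close>, read off at x^m: in
  Vandermonde's sum all inner coefficients \<open>p choose k\<close> are divisible by
  \<open>p\<close>.\<close>

lemma choose_add_prime_cong:
  fixes p N m :: nat
  assumes "prime p"
  shows "[(p + N) choose m = (N choose m) + (if m < p then 0 else N choose (m - p))] (mod p)"
proof -
  \<comment> \<open>The two surviving terms, \<open>k = 0\<close> and \<open>k = p\<close>; the
    second is in the range \<open>k \<le> m\<close> only if \<open>m \<ge> p\<close>.\<close>
  let ?g = "\<lambda>k. (if k = 0 then N choose m else 0) + (if k = p then N choose (m - p) else 0)"
  have p0: "p > 0" using assms prime_gt_0_nat by blast
  have "[(\<Sum>k\<le>m. (p choose k) * (N choose (m - k))) = (\<Sum>k\<le>m. ?g k)] (mod p)"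
  proof (rule cong_sum)
    fix k
    show "[(p choose k) * (N choose (m - k)) = ?g k] (mod p)"
    proof (cases "k = 0 \<or> k = p \<or> k > p")
      case True
      then show ?thesis using p0 by (auto simp: binomial_eq_0)
    next
      case False
      then have "p dvd (p choose k)" using assms dvd_choose_prime[of k p] by auto
      then show ?thesis using False by (simp add: cong_0_iff)
    qed
  qed
  moreover have "(\<Sum>k\<le>m. ?g k) = (N choose m) + (if m < p then 0 else N choose (m - p))"
    by (auto simp: sum.distrib)
  ultimately show ?thesis by (simp add: vandermonde)
qed

text \<open>Induction in steps of \<open>p\<close>: subtracting \<open>p\<close> from
  \<open>n\<close> lowers the quotient by one and keeps the remainder, so the previous congruence
  turns into Pascal's rule for the quotients.\<close>

lemma lucas_choose_step:
  fixes p n m :: nat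
  assumes "prime p"
  shows "[n choose m = (n div p choose (m div p)) * (n mod p choose (m mod p))] (mod p)"
proof (induction n arbitrary: m rule: less_induct)
  case (less n)
  have p0: "p > 0" using assms prime_gt_0_nat by blast
  show ?case
  proof (cases "n < p")
    case True
    show ?thesis
    proof (cases "m < p")
      case False
      then have "m div p > 0" using p0 by (simp add: div_greater_zero_iff)
      then show ?thesis using True False by (simp add: binomial_eq_0)
    qed (use True in simp)
  next
    case False
    define N where "N = n - p"
    have n: "n = p + N" and N: "N < n" using False p0 by (auto simp: N_def)
    have dn: "n div p = Suc (N div p)" "n mod p = N mod p" using p0 by (auto simp: n)
    have *: "[n choose m = (N choose m) + (if m < p then 0 else N choose (m - p))] (mod p)"
      unfolding n by (rule choose_add_prime_cong[OF assms])
    show ?thesis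
    proof (cases "m < p")
      case True
      then show ?thesis using * less.IH[OF N, of m] by (auto simp: dn elim: cong_trans)
    next
      case False
      define M where "M = m - p"
      have m: "m = p + M" using False by (simp add: M_def)
      have dm: "m div p = Suc (M div p)" "m mod p = M mod p" using p0 by (auto simp: m)
      have "[(N choose m) + (N choose M) =
          (N div p choose (m div p)) * (N mod p choose (m mod p)) +
          (N div p choose (M div p)) * (N mod p choose (M mod p))] (mod p)"
        by (intro cong_add less.IH N)
      also have "(N div p choose (m div p)) * (N mod p choose (m mod p)) +
          (N div p choose (M div p)) * (N mod p choose (M mod p)) =
          (n div p choose (m div p)) * (n mod p choose (m mod p))"
        by (simp add: dn dm algebra_simps)
      finally show ?thesis using * False by (auto simp: M_def elim: cong_trans)
    qed
  qed
qed

lemma prod_list_fact_dvd: "prod_list (map fact ms) dvd (fact (sum_list ms) :: nat)"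
proof (induction ms)
  case (Cons c ms)
  have "fact c * prod_list (map fact ms) dvd (fact c * fact (sum_list ms) :: nat)"
    using Cons by simp
  also have "\<dots> dvd fact (c + sum_list ms)" by (rule fact_fact_dvd_fact)
  finally show ?case by simp
qed simp

lemma multinom_Nil: "multinom m [] = (if m = 0 then 1 else 0)"
  by (simp add: multinom_def)

lemma multinom_mult_fact:
  "sum_list ms = m \<Longrightarrow> multinom m ms * prod_list (map fact ms) = fact m"
  using prod_list_fact_dvd[of ms] by (auto simp: multinom_def)

text \<open>Holds without a condition on the sum: if the parts do not add up to \<open>m\<close>,
  then the binomial vanishes (\<open>c > m\<close>) or the smaller multinomial does. This makes
  induction on the list possible.\<close>

lemma multinom_Cons: "multinom m (c # ms) = (m choose c) * multinom (m - c) ms"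
proof (cases "c + sum_list ms = m")
  case True
  then have c: "c \<le> m" "m - c = sum_list ms" by auto
  have "multinom m (c # ms) * prod_list (map fact (c # ms)) = fact m"
    by (rule multinom_mult_fact) (use True in simp)
  also have "\<dots> = (m choose c) * (fact c * fact (m - c))"
    using binomial_fact_lemma[OF c(1)] by (simp add: algebra_simps)
  also have "\<dots> = (m choose c) * multinom (m - c) ms * prod_list (map fact (c # ms))"
    using multinom_mult_fact[of ms "m - c"] c by (simp add: algebra_simps)
  finally show ?thesis
    by (auto simp: prod_list_zero_iff)
next
  case False
  then show ?thesis by (cases "c \<le> m") (auto simp: multinom_def binomial_eq_0)
qed

lemma lucas_multinom_step:
  assumes "prime p"
  shows "[multinom n ms = multinom (n div p) (map (\<lambda>m. m div p) ms) *
            multinom (n mod p) (map (\<lambda>m. m mod p) ms)] (mod p)"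
proof (induction ms arbitrary: n)
  case Nil
  have "n = 0 \<longleftrightarrow> n div p = 0 \<and> n mod p = 0"
    by (metis div_0 mod_0 div_mult_mod_eq add_0 mult_0)
  then show ?case by (auto simp: multinom_Nil)
next
  case (Cons m ms)
  let ?d = "map (\<lambda>m. m div p) ms" and ?r = "map (\<lambda>m. m mod p) ms"
  let ?B = "(n div p choose (m div p)) * (n mod p choose (m mod p))"
  have "[multinom n (m # ms) = ?B *
       (multinom ((n - m) div p) ?d * multinom ((n - m) mod p) ?r)] (mod p)"
    unfolding multinom_Cons by (intro cong_mult lucas_choose_step Cons assms)
  \<comment> \<open>Quotient and remainder of \<open>n - m\<close> are the differences only if the
    subtraction needs no borrow; otherwise one of the two binomials in \<open>?B\<close> is 0 and
    nothing has to be compared.\<close>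
  also have "?B * (multinom ((n - m) div p) ?d * multinom ((n - m) mod p) ?r) =
     ?B * (multinom (n div p - m div p) ?d * multinom (n mod p - m mod p) ?r)"
  proof (cases "m div p \<le> n div p \<and> m mod p \<le> n mod p")
    case True
    define a b where "a = n div p - m div p" and "b = n mod p - m mod p"
    have p0: "p > 0" using assms prime_gt_0_nat by blast
    have "n div p = m div p + a" "n mod p = m mod p + b"
      using True by (simp_all add: a_def b_def)
    then have "n = (m div p + a) * p + (m mod p + b)" by (metis div_mult_mod_eq)
    also have "\<dots> = (m div p * p + m mod p) + (a * p + b)" by (simp only: add_mult_distrib add_ac)
    also have "m div p * p + m mod p = m" by simp
    finally have "n - m = a * p + b" by simp
    moreover have "b < p" using p0 unfolding b_def by (meson less_imp_diff_less mod_less_divisor)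
    ultimately have "(n - m) div p = a" "(n - m) mod p = b" by auto
    then show ?thesis by (simp add: a_def b_def)
  qed (auto simp: binomial_eq_0 not_le)
  finally show ?case by (simp add: multinom_Cons mult_ac)
qed

text \<open>The last factor is what remains after \<open>K\<close> digits have been split off; it
  becomes 1 as soon as \<open>p ^ K\<close> exceeds \<open>n\<close> and all parts.\<close>

lemma lucas_multinom_digits:
  assumes "prime p"
  shows "[multinom n ms = (\<Prod>j<K. multinom (digit p j n) (map (digit p j) ms)) *
            multinom (n div p ^ K) (map (\<lambda>m. m div p ^ K) ms)] (mod p)"
proof (induction K)
  case (Suc K)
  have "[multinom (n div p ^ K) (map (\<lambda>m. m div p ^ K) ms) =
     multinom (n div p ^ K div p) (map (\<lambda>m. m div p) (map (\<lambda>m. m div p ^ K) ms)) *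
     multinom (n div p ^ K mod p) (map (\<lambda>m. m mod p) (map (\<lambda>m. m div p ^ K) ms))] (mod p)"
    by (rule lucas_multinom_step[OF assms])
  then have "[multinom (n div p ^ K) (map (\<lambda>m. m div p ^ K) ms) =
     multinom (digit p K n) (map (digit p K) ms) *
     multinom (n div p ^ Suc K) (map (\<lambda>m. m div p ^ Suc K) ms)] (mod p)"
    by (simp add: o_def digit_def[abs_def] mult_ac flip: div_mult2_eq power_Suc2)
  from cong_trans[OF Suc cong_scalar_left[OF this]] show ?case
    by (simp add: mult_ac)
qed simp

lemma multinom_zeros: "(\<forall>m\<in>set ms. m = 0) \<Longrightarrow> multinom 0 ms = 1"
  by (induction ms) (auto simp: multinom_Nil multinom_Cons)

lemma lucas_multinom:
  assumes "prime p" "n < p ^ (k + 1)" "sum_list ms = n"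
  shows "[multinom n ms = (\<Prod>j\<le>k. multinom (digit p j n) (map (digit p j) ms))] (mod p)"
proof -
  have "m div p ^ Suc k = 0" if "m \<in> set ms" for m
    using that assms(2,3) member_le_sum_list[of m ms] by simp
  then have "multinom (n div p ^ Suc k) (map (\<lambda>m. m div p ^ Suc k) ms) = 1"
    using assms(2) by (simp add: multinom_zeros)
  then show ?thesis
    using lucas_multinom_digits[OF assms(1), of n ms "Suc k"] by (simp add: lessThan_Suc_atMost)
qed

section \<open>Base-p digits and powers modulo p\<close>

lemma sum_digits_lessThan: "p > 0 \<Longrightarrow> (\<Sum>j<K. digit p j m * p ^ j) = m mod p ^ K"
proof (induction K)
  case (Suc K)
  have "m mod p ^ Suc K = p ^ K * (m div p ^ K mod p) + m mod p ^ K"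
    unfolding power_Suc2 by (rule mod_mult2_eq)
  with Suc show ?case by (simp add: digit_def)
qed simp

lemma sum_digits: "p > 0 \<Longrightarrow> m < p ^ (k + 1) \<Longrightarrow> (\<Sum>j\<le>k. digit p j m * p ^ j) = m"
  using sum_digits_lessThan[of p m "Suc k"] by (simp add: lessThan_Suc_atMost)

lemma fermat_power_cong:
  fixes a :: nat
  assumes "prime p"
  shows "[a ^ (p ^ j) = a] (mod p)"
proof (induction j)
  case (Suc j)
  have "[a ^ p = a] (mod p)"
  proof (cases "p dvd a")
    case True
    then have "p dvd a ^ p" using prime_gt_0_nat[OF assms] by (meson dvd_power dvd_trans)
    then show ?thesis using True by (simp add: cong_def dvd_eq_mod_eq_0)
  next
    case False
    have "[a * a ^ (p - 1) = a * 1] (mod p)"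
      by (intro cong_mult fermat_theorem assms False cong_refl)
    moreover have "a * a ^ (p - 1) = a ^ p"
      using assms prime_gt_0_nat[of p] by (simp add: power_eq_if)
    ultimately show ?thesis by simp
  qed
  then have "[(a ^ p) ^ (p ^ j) = a ^ (p ^ j)] (mod p)" by (rule cong_pow)
  with Suc show ?case by (auto simp: power_mult elim: cong_trans)
qed simp

text \<open>Each \<open>p ^ j\<close> in the exponent acts as 1 by Fermat. The coefficients
  \<open>e j\<close> are arbitrary, so that differences of digits can be inserted too.\<close>

lemma fermat_digit_power_cong:
  fixes a :: nat
  assumes "prime p"
  shows "[a ^ (\<Sum>j\<le>k. e j * p ^ j) = (\<Prod>j\<le>k. a ^ e j)] (mod p)"
  unfolding power_sum power_mult
  by (intro cong_prod fermat_power_cong assms)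

section \<open>Counting signed block arrangements\<close>

lemma pdesc_single [simp]: "pdesc [x] = {}"
  by (auto simp: pdesc_def)

text \<open>The recursion at the right end, on which every argument that removes the last block
  rests.\<close>

lemma pdesc_snoc: "xs \<noteq> [] \<Longrightarrow> pdesc (xs @ [c]) = insert (sum_list xs) (pdesc xs)"
proof -
  assume "xs \<noteq> []"
  then have "{j. 1 \<le> j \<and> j < length (xs @ [c])} = insert (length xs) {j. 1 \<le> j \<and> j < length xs}"
    by (auto simp: Suc_le_eq)
  moreover have "pdesc ys = (\<lambda>j. sum_list (take j ys)) ` {j. 1 \<le> j \<and> j < length ys}" for ys
    by (auto simp: pdesc_def)
  ultimately show ?thesis by auto
qed

lemma pdesc_Cons: "xs \<noteq> [] \<Longrightarrow> pdesc (x # xs) = insert x ((+) x ` pdesc xs)"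
proof (induction xs rule: rev_induct)
  case (snoc c xs)
  show ?case
  proof (cases "xs = []")
    case True
    then show ?thesis using pdesc_snoc[of "[x]" c] by simp
  next
    case False
    then show ?thesis
      using snoc.IH pdesc_snoc[of "x # xs" c] pdesc_snoc[of xs c] by auto
  qed
qed simp

lemma multinom_snoc: "multinom m (ms @ [c]) = (m choose c) * multinom (m - c) ms"
proof -
  have "multinom m (ms @ [c]) = multinom m (c # ms)"
    by (simp add: multinom_def mult_ac add_ac)
  then show ?thesis by (simp only: multinom_Cons)
qed

text \<open>The possible fillings of a block other than the first, where position 0 plays no
  part.\<close>

definition signed_blocks :: "int set \<Rightarrow> nat \<Rightarrow> int list set" where
  "signed_blocks A c = {zs. sorted_wrt (<) zs \<and> length zs = c \<and> distinct (map abs zs) \<and> abs ` set zs \<subseteq> A}"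

text \<open>A block is determined by its set \<open>C\<close> of absolute values and the subset
  \<open>N\<close> of those that are negated; the increasing order is then forced.\<close>

lemma card_signed_blocks:
  assumes "finite A" "\<And>a. a \<in> A \<Longrightarrow> a > 0"
  shows "card (signed_blocks A c) = (card A choose c) * 2 ^ c"
proof -
  let ?S = "SIGMA C:{C. C \<subseteq> A \<and> card C = c}. Pow C"
  let ?f = "\<lambda>zs. (abs ` set zs, {a \<in> abs ` set zs. - a \<in> set zs})"
  let ?V = "\<lambda>C N. (C - N) \<union> uminus ` N"
  let ?g = "\<lambda>(C, N). sorted_list_of_set (?V C N)"
  \<comment> \<open>\<open>?V C N\<close> is the set of entries recovered from \<open>C\<close> and
    \<open>N\<close>; as \<open>A\<close> is positive, no absolute value occurs in it twice.\<close>
  have V: "finite (?V C N)" "inj_on abs (?V C N)" "abs ` ?V C N = C" "{a \<in> C. - a \<in> ?V C N} = N"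
    if "C \<subseteq> A" "N \<subseteq> C" for C N
  proof -
    have pos: "a > 0" if "a \<in> C" for a using assms(2) that \<open>C \<subseteq> A\<close> by blast
    have posN: "a > 0" if "a \<in> N" for a using pos that \<open>N \<subseteq> C\<close> by blast
    show "finite (?V C N)" using that assms(1) by (meson finite_Diff finite_UnI finite_imageI finite_subset)
    show "inj_on abs (?V C N)"
    proof (rule inj_onI)
      fix x y assume "x \<in> ?V C N" "y \<in> ?V C N" "\<bar>x\<bar> = \<bar>y\<bar>"
      then show "x = y"
        using pos[of x] pos[of y] posN[of "- x"] posN[of "- y"] by auto
    qed
    show "abs ` ?V C N = C"
    proof
      show "abs ` ?V C N \<subseteq> C" using that by (auto simp: abs_if dest: pos posN)
      show "C \<subseteq> abs ` ?V C N"
      proof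
        fix a assume "a \<in> C"
        then show "a \<in> abs ` ?V C N"
          using pos[of a] by (cases "a \<in> N") (auto simp: image_iff intro: bexI[of _ "-a"] bexI[of _ a])
      qed
    qed
    show "{a \<in> C. - a \<in> ?V C N} = N"
      using that pos by (auto dest!: pos)
  qed
  have "bij_betw ?f (signed_blocks A c) ?S"
  proof (rule bij_betw_byWitness[where f' = ?g])
    show "\<forall>zs \<in> signed_blocks A c. ?g (?f zs) = zs"
    proof
      fix zs assume "zs \<in> signed_blocks A c"
      then have zs: "sorted_wrt (<) zs" "inj_on abs (set zs)" "abs ` set zs \<subseteq> A"
        by (auto simp: signed_blocks_def distinct_map)
      have abs_eq: "z = y" if "z \<in> set zs" "y \<in> set zs" "\<bar>z\<bar> = \<bar>y\<bar>" for z y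
        using that zs(2) by (auto dest: inj_onD)
      have "?V (fst (?f zs)) (snd (?f zs)) = set zs"
      proof (intro equalityI subsetI)
        fix z assume "z \<in> ?V (fst (?f zs)) (snd (?f zs))"
        then show "z \<in> set zs" by (auto simp: abs_if split: if_splits)
      next
        fix z assume z: "z \<in> set zs"
        show "z \<in> ?V (fst (?f zs)) (snd (?f zs))"
        proof (cases "z > 0")
          case True
          then have "- z \<notin> set zs" using abs_eq[OF z, of "- z"] by auto
          then show ?thesis using z True by (auto simp: image_iff intro!: bexI[of _ z])
        next
          case False
          then have "- z \<in> snd (?f zs)" using z by (auto simp: image_iff intro!: bexI[of _ z])
          then show ?thesis by (intro UnI2 image_eqI[of _ _ "- z"]) simp_all
        qed
      qed
      then show "?g (?f zs) = zs"
        using zs(1) by (simp add: sorted_list_of_set.idem_if_sorted_distinct strict_sorted_iff)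
    qed
    show "\<forall>CN \<in> ?S. ?f (?g CN) = CN"
    proof
      fix CN assume "CN \<in> ?S"
      then obtain C N where e: "CN = (C, N)" and CN: "C \<subseteq> A" "N \<subseteq> C" by auto
      show "?f (?g CN) = CN"
        unfolding e split using V[OF CN] by (simp only: set_sorted_list_of_set)
    qed
    show "?f ` signed_blocks A c \<subseteq> ?S"
      by (auto simp: signed_blocks_def distinct_map card_image distinct_card)
    show "?g ` ?S \<subseteq> signed_blocks A c"
    proof clarify
      fix C N assume CN: "C \<subseteq> A" "N \<subseteq> C"
      note V = V[OF CN]
      have "card (?V C N) = card C" using V(2,3) by (metis card_image)
      then show "sorted_list_of_set (?V C N) \<in> signed_blocks A (card C)"
        using V CN by (simp add: signed_blocks_def distinct_map)
    qed
  qed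
  then have "card (signed_blocks A c) = card ?S" by (rule bij_betw_same_card)
  also have "\<dots> = (\<Sum>C\<in>{C. C \<subseteq> A \<and> card C = c}. card (Pow C))"
    using assms(1) by (intro card_SigmaI) (auto intro: finite_subset)
  also have "\<dots> = (\<Sum>C\<in>{C. C \<subseteq> A \<and> card C = c}. 2 ^ c)"
    using assms(1) by (intro sum.cong) (auto simp: card_Pow finite_subset)
  also have "\<dots> = (card A choose c) * 2 ^ c"
    using n_subsets[OF assms(1), of c] by simp
  finally show ?thesis .
qed

section \<open>Words with prescribed ascents\<close>

text \<open>\<open>wext\<close> for one-line notation: lists count from 0, so \<open>xs ! 1\<close>
  is w(2). Position 0 is meaningful only for words of length at least 2.\<close>

definition list_wext :: "int list \<Rightarrow> nat \<Rightarrow> int" where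
  "list_wext xs i = (if i = 0 then - xs ! 1 else xs ! (i - 1))"

text \<open>Expresses that all descents lie in \<open>pdesc b\<close>. The form with
  \<open><\<close> is equivalent to the absence of a descent because neighbouring values never
  tie.\<close>

definition ascending :: "nat list \<Rightarrow> int list \<Rightarrow> bool" where
  "ascending b xs \<longleftrightarrow> (\<forall>i < sum_list b. i \<notin> pdesc b \<longrightarrow> list_wext xs i < list_wext xs (Suc i))"

text \<open>The set \<open>A\<close> of absolute values is kept general since removing a block
  leaves an arbitrary set of remaining values.\<close>

definition block_arrangements :: "nat list \<Rightarrow> int set \<Rightarrow> int list set" where
  "block_arrangements b A = {xs. distinct (map abs xs) \<and> abs ` set xs = A \<and>
     length xs = sum_list b \<and> ascending b xs}"

lemma pdesc_le: "i \<in> pdesc b \<Longrightarrow> i \<le> sum_list b"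
proof -
  have "sum_list (take j b) \<le> sum_list b" for j
    using sum_list_append[of "take j b" "drop j b"] by simp
  then show "i \<in> pdesc b \<Longrightarrow> i \<le> sum_list b" by (auto simp: pdesc_def)
qed

text \<open>No tested comparison crosses the cut between \<open>ys\<close> and \<open>zs\<close>:
  position \<open>sum_list b\<close> is exempt, and \<open>hd b \<noteq> 1\<close> ensures that
  position 0, if tested, sees only entries of \<open>ys\<close>.\<close>

lemma ascending_snoc:
  assumes "b \<noteq> []" "hd b \<noteq> 1" "length ys = sum_list b" "length zs = c"
  shows "ascending (b @ [c]) (ys @ zs) \<longleftrightarrow> ascending b ys \<and> sorted_wrt (<) zs"
proof -
  let ?s = "sum_list b" and ?P = "\<lambda>xs i. list_wext xs i < list_wext xs (Suc i)"
  have low: "?P (ys @ zs) i \<longleftrightarrow> ?P ys i" if "i < ?s" "i \<notin> pdesc b" for i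
  proof (cases i)
    case 0
    \<comment> \<open>Position 0 reads the first two entries. If the head is 0, then either 0 lies
      in \<open>pdesc b\<close> or \<open>ys\<close> is empty, so a tested position 0 forces a head
      of at least 2.\<close>
    have "?s \<ge> 2"
    proof (cases b)
      case (Cons x xs)
      have "x \<noteq> 0"
      proof
        assume x: "x = 0"
        then have "xs \<noteq> []" using that 0 Cons by auto
        then show False using that 0 Cons x pdesc_Cons[of xs x] by simp
      qed
      then show ?thesis using Cons assms(2) by auto
    qed (use assms in simp)
    then show ?thesis using 0 assms(3) by (simp add: list_wext_def nth_append)
  next
    case (Suc j)
    then show ?thesis using assms(3) that by (simp add: list_wext_def nth_append)
  qed
  have high: "?P (ys @ zs) (?s + Suc j) \<longleftrightarrow> zs ! j < zs ! Suc j" for j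
    using assms(3) by (simp add: list_wext_def nth_append)
  have "ascending (b @ [c]) (ys @ zs) \<longleftrightarrow>
      (\<forall>i < ?s + c. i \<noteq> ?s \<and> i \<notin> pdesc b \<longrightarrow> ?P (ys @ zs) i)"
    by (simp add: ascending_def pdesc_snoc[OF assms(1)])
  also have "\<dots> \<longleftrightarrow> (\<forall>i < ?s. i \<notin> pdesc b \<longrightarrow> ?P (ys @ zs) i) \<and>
      (\<forall>j. Suc j < c \<longrightarrow> ?P (ys @ zs) (?s + Suc j))" (is "?L \<longleftrightarrow> ?R")
  proof
    assume L: ?L
    show ?R
    proof (intro conjI allI impI)
      fix j assume "Suc j < c"
      moreover have "?s + Suc j \<notin> pdesc b" using pdesc_le[of "?s + Suc j" b] by auto
      ultimately show "?P (ys @ zs) (?s + Suc j)" using L by auto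
    qed (use L in auto)
  next
    assume R: ?R
    show ?L
    proof (intro allI impI)
      fix i assume i: "i < ?s + c" "i \<noteq> ?s \<and> i \<notin> pdesc b"
      show "?P (ys @ zs) i"
      proof (cases "i < ?s")
        case False
        then have "i = ?s + Suc (i - ?s - 1)" "Suc (i - ?s - 1) < c" using i by auto
        then show ?thesis using R by metis
      qed (use R i in auto)
    qed
  qed
  also have "\<dots> \<longleftrightarrow> ascending b ys \<and> sorted_wrt (<) zs"
    using low high assms(4) by (auto simp: ascending_def sorted_wrt_iff_nth_Suc_transp)
  finally show ?thesis .
qed

lemma subset_Un_uminus:
  fixes A X :: "int set"
  assumes "abs ` X \<subseteq> A"
  shows "X \<subseteq> A \<union> uminus ` A"
proof
  fix x assume "x \<in> X"
  then have "\<bar>x\<bar> \<in> A" using assms by blast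
  then show "x \<in> A \<union> uminus ` A"
    by (cases "x \<ge> 0") (auto simp: image_iff intro!: bexI[of _ "- x"])
qed

lemma finite_block_arrangements: "finite A \<Longrightarrow> finite (block_arrangements b A)"
proof (rule finite_subset)
  show "block_arrangements b A \<subseteq> {xs. set xs \<subseteq> A \<union> uminus ` A \<and> length xs = sum_list b}"
    unfolding block_arrangements_def using subset_Un_uminus[OF equalityD1] by blast
qed (auto intro: finite_lists_length_eq)

text \<open>Choose the last block first; the remaining blocks arrange the remaining absolute values.
  Their number \<open>K\<close> depends only on how many values remain, so the count is a
  product.\<close>

lemma card_block_arrangements_snoc:
  assumes "b \<noteq> []" "hd b \<noteq> 1" "finite A" "\<And>a. a \<in> A \<Longrightarrow> a > 0" "card A = sum_list b + c"
    and "\<And>B. finite B \<Longrightarrow> B \<subseteq> A \<Longrightarrow> card B = sum_list b \<Longrightarrow> card (block_arrangements b B) = K"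
  shows "card (block_arrangements (b @ [c]) A) = (card A choose c) * 2 ^ c * K"
proof -
  let ?S = "SIGMA zs:signed_blocks A c. block_arrangements b (A - abs ` set zs)"
  have rest: "finite (A - abs ` set zs)" "card (A - abs ` set zs) = sum_list b"
    if "zs \<in> signed_blocks A c" for zs
  proof -
    have "abs ` set zs \<subseteq> A" "card (abs ` set zs) = c"
      using that by (auto simp: signed_blocks_def distinct_map card_image distinct_card)
    then show "card (A - abs ` set zs) = sum_list b" using assms(5) by (simp add: card_Diff_subset)
  qed (use assms in auto)
  have "bij_betw (\<lambda>xs. (drop (sum_list b) xs, take (sum_list b) xs))
          (block_arrangements (b @ [c]) A) ?S"
  proof (rule bij_betw_byWitness[where f' = "\<lambda>(zs, ys). ys @ zs"])
    show "(\<lambda>xs. (drop (sum_list b) xs, take (sum_list b) xs)) ` block_arrangements (b @ [c]) A \<subseteq> ?S"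
    proof clarify
      fix xs assume xs: "xs \<in> block_arrangements (b @ [c]) A"
      define ys zs where "ys = take (sum_list b) xs" and "zs = drop (sum_list b) xs"
      have e: "xs = ys @ zs" by (simp add: ys_def zs_def)
      have len: "length ys = sum_list b" "length zs = c"
        using xs by (auto simp: ys_def zs_def block_arrangements_def)
      have "zs \<in> signed_blocks A c \<and> ys \<in> block_arrangements b (A - abs ` set zs)"
        using xs len unfolding e block_arrangements_def signed_blocks_def
        by (auto simp: ascending_snoc[OF assms(1,2) len])
      then show "zs \<in> signed_blocks A c \<and> ys \<in> block_arrangements b (A - abs ` set zs)" .
    qed
    show "(\<lambda>(zs, ys). ys @ zs) ` ?S \<subseteq> block_arrangements (b @ [c]) A"
    proof clarify
      fix zs ys assume zs: "zs \<in> signed_blocks A c" and ys: "ys \<in> block_arrangements b (A - abs ` set zs)"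
      have len: "length ys = sum_list b" "length zs = c"
        using zs ys by (auto simp: block_arrangements_def signed_blocks_def)
      show "ys @ zs \<in> block_arrangements (b @ [c]) A"
        using zs ys len unfolding block_arrangements_def signed_blocks_def
        by (auto simp: ascending_snoc[OF assms(1,2) len])
    qed
  qed (auto simp: block_arrangements_def)
  then have "card (block_arrangements (b @ [c]) A) = card ?S" by (rule bij_betw_same_card)
  also have "\<dots> = (\<Sum>zs\<in>signed_blocks A c. card (block_arrangements b (A - abs ` set zs)))"
  proof (rule card_SigmaI)
    show "finite (signed_blocks A c)"
    proof (rule finite_subset)
      show "signed_blocks A c \<subseteq> {xs. set xs \<subseteq> A \<union> uminus ` A \<and> length xs = c}"
        unfolding signed_blocks_def using subset_Un_uminus by blast
    qed (use assms(3) in \<open>auto intro: finite_lists_length_eq\<close>)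
  qed (use assms(3) in \<open>auto intro: finite_block_arrangements\<close>)
  also have "\<dots> = (\<Sum>zs\<in>signed_blocks A c. K)"
    using rest by (intro sum.cong refl assms(6)) auto
  finally show ?thesis by (simp add: card_signed_blocks[OF assms(3,4)])
qed

text \<open>The tests at 0 and 1 say \<open>- y < x\<close> and \<open>x < y\<close>, that is
  \<open>\<bar>x\<bar> < y\<close>. So the word is \<open>A\<close> in increasing order, with a free
  sign on its first entry: the index 2 of the even signed permutations among all of them.\<close>

lemma card_block_arrangements_single:
  assumes "finite A" "\<And>a. a \<in> A \<Longrightarrow> a > 0" "card A = b" "b \<ge> 2"
  shows "card (block_arrangements [b] A) = 2"
proof -
  have asc: "ascending [b] (x # y # xs) \<longleftrightarrow> sorted_wrt (<) (\<bar>x\<bar> # y # xs)"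
    if "length (x # y # xs) = b" for x y xs
  proof -
    have "ascending [b] (x # y # xs) \<longleftrightarrow> - y < x \<and> x < y \<and> sorted_wrt (<) (y # xs)"
    proof -
      have "ascending [b] (x # y # xs) \<longleftrightarrow> (\<forall>i < Suc (Suc (length xs)). list_wext (x # y # xs) i < list_wext (x # y # xs) (Suc i))"
        using that by (auto simp: ascending_def)
      also have "\<dots> \<longleftrightarrow> - y < x \<and> x < y \<and> (\<forall>i. Suc i < length (y # xs) \<longrightarrow> (y # xs) ! i < (y # xs) ! Suc i)"
        by (simp add: All_less_Suc2 list_wext_def del: nth_Cons_Suc)
      finally show ?thesis by (simp add: sorted_wrt_iff_nth_Suc_transp del: sorted_wrt.simps)
    qed
    then show ?thesis by (auto simp: sorted_wrt2 abs_less_iff simp del: sorted_wrt.simps)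
  qed
  obtain x y xs where L: "sorted_list_of_set A = x # y # xs"
    using assms(3,4) by (metis One_nat_def Suc_1 Suc_le_length_iff length_sorted_list_of_set)
  have A: "A = {x, y} \<union> set xs" "sorted_wrt (<) (x # y # xs)" "length (x # y # xs) = b"
    using assms(1,3) L
      apply (metis set_sorted_list_of_set list.simps(15) insert_is_Un Un_assoc)
     apply (metis L strict_sorted_list_of_set)
    by (metis L assms(3) length_sorted_list_of_set)
  have pos: "x > 0" "y > 0" "\<And>z. z \<in> set xs \<Longrightarrow> z > 0" using assms(2) A by auto
  have "block_arrangements [b] A = {x # y # xs, - x # y # xs}"
  proof (intro equalityI subsetI)
    fix us assume us: "us \<in> block_arrangements [b] A"
    then obtain u v vs where uv: "us = u # v # vs"
      using assms(4) by (auto simp: block_arrangements_def Suc_le_length_iff numeral_2_eq_2)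
    then have "length (u # v # vs) = b" "abs ` set (u # v # vs) = A"
      and "ascending [b] (u # v # vs)" using us by (auto simp: block_arrangements_def)
    then have srt: "sorted_wrt (<) (\<bar>u\<bar> # v # vs)" using asc by blast
    then have "abs ` set (v # vs) = set (v # vs)" by force
    then have "set (\<bar>u\<bar> # v # vs) = set (x # y # xs)"
      using \<open>abs ` set (u # v # vs) = A\<close> A(1) by simp
    then have "\<bar>u\<bar> # v # vs = x # y # xs"
      using srt A(2) strict_sorted_equal by blast
    then show "us \<in> {x # y # xs, - x # y # xs}" using uv by auto
  next
    fix us assume "us \<in> {x # y # xs, - x # y # xs}"
    then obtain u where u: "us = u # y # xs" "\<bar>u\<bar> = x" using pos by auto
    have "map abs xs = xs" using pos(3) by (intro map_idI) force
    then have "map abs us = x # y # xs" using u pos by simp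
    moreover have "distinct (x # y # xs)" using A(2) strict_sorted_iff by blast
    ultimately have "distinct (map abs us)" "set (map abs us) = A" "length us = b"
      using A(1,3) u(1) by simp_all
    moreover have "ascending [b] us" using u A asc by auto
    ultimately show "us \<in> block_arrangements [b] A"
      by (simp add: block_arrangements_def)
  qed
  then show ?thesis using pos by simp
qed

text \<open>Every later block contributes one sign choice per entry, while a nonempty first block
  has a single free sign. The case \<open>b = 1\<close> is excluded because position 0 would then
  tie two blocks together.\<close>

lemma card_block_arrangements:
  assumes "finite A" "\<And>a. a \<in> A \<Longrightarrow> a > 0" "card A = sum_list (b # cs)" "b \<noteq> 1"
  shows "card (block_arrangements (b # cs) A) =
    (if b = 0 then 1 else 2) * 2 ^ sum_list cs * multinom (sum_list (b # cs)) (b # cs)"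
  using assms(1-3)
proof (induction cs arbitrary: A rule: rev_induct)
  case Nil
  show ?case
  proof (cases "b = 0")
    case True
    then have "A = {}" using Nil by simp
    then have "block_arrangements [b] A = {[]}"
      using True by (auto simp: block_arrangements_def ascending_def)
    then show ?thesis using True by (simp add: multinom_Cons multinom_Nil)
  next
    case False
    then show ?thesis using card_block_arrangements_single[of A b] assms(4) Nil
      by (simp add: multinom_Cons multinom_Nil)
  qed
next
  case (snoc c cs)
  have "card (block_arrangements ((b # cs) @ [c]) A) = (card A choose c) * 2 ^ c *
    ((if b = 0 then 1 else 2) * 2 ^ sum_list cs * multinom (sum_list (b # cs)) (b # cs))"
    using snoc.prems by (intro card_block_arrangements_snoc snoc.IH) (use assms(4) in auto)
  then show ?case
    using snoc.prems multinom_snoc[of "sum_list (b # cs @ [c])" "b # cs" c]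
    by (simp add: power_add)
qed

section \<open>Descent classes of signed permutations\<close>

lemma finite_signed_perms: "finite (signed_perms n)"
proof (rule finite_subset)
  show "signed_perms n \<subseteq> {w. \<forall>i. (i \<in> {1..n} \<longrightarrow> w i \<in> {- int n..int n}) \<and> (i \<notin> {1..n} \<longrightarrow> w i = 0)}"
  proof
    fix w assume w: "w \<in> signed_perms n"
    have "w i \<in> {- int n..int n}" if "i \<in> {1..n}" for i
    proof -
      have "nat \<bar>w i\<bar> \<in> {1..n}"
        using w that unfolding signed_perms_def bij_betw_def by blast
      then show ?thesis by auto
    qed
    then show "w \<in> {w. \<forall>i. (i \<in> {1..n} \<longrightarrow> w i \<in> {- int n..int n}) \<and> (i \<notin> {1..n} \<longrightarrow> w i = 0)}"
      using w by (auto simp: signed_perms_def)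
  qed
  show "finite {w. \<forall>i. (i \<in> {1..n} \<longrightarrow> w i \<in> {- int n..int n}) \<and> (i \<notin> {1..n} \<longrightarrow> w i = (0::int))}"
    by (rule finite_set_of_finite_funs) auto
qed

lemma signed_perms_abs_neq:
  assumes "w \<in> signed_perms n" "i \<in> {1..n}" "j \<in> {1..n}" "i \<noteq> j"
  shows "\<bar>w i\<bar> \<noteq> \<bar>w j\<bar>"
proof
  assume "\<bar>w i\<bar> = \<bar>w j\<bar>"
  then have "nat \<bar>w i\<bar> = nat \<bar>w j\<bar>" by (rule arg_cong)
  then show False
    using assms by (auto simp: signed_perms_def bij_betw_def dest: inj_onD)
qed

lemma signed_perms_nonzero:
  assumes "w \<in> signed_perms n" "i \<in> {1..n}"
  shows "w i \<noteq> 0"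
proof -
  have "nat \<bar>w i\<bar> \<in> {1..n}"
    using assms unfolding signed_perms_def bij_betw_def by blast
  then show ?thesis by auto
qed

lemma wext_neq:
  assumes "w \<in> signed_perms n" "n \<ge> 2" "i < n"
  shows "wext w i \<noteq> wext w (Suc i)"
proof (cases "i = 0")
  case True
  then show ?thesis using signed_perms_abs_neq[OF assms(1), of 1 2] assms(2) by (auto simp: wext_def)
next
  case False
  then show ?thesis using signed_perms_abs_neq[OF assms(1), of i "Suc i"] assms(3) by (auto simp: wext_def)
qed

text \<open>The bijection is one-line notation; the index shift \<open>i - 1\<close> and the value 0
  outside \<open>{1..n}\<close> match the encoding of \<open>signed_perms\<close>.\<close>

lemma card_signed_perms_block:
  assumes "sum_list b = n" "n \<ge> 2"
  shows "card {w \<in> signed_perms n. descD n w \<subseteq> pdesc b} = card (block_arrangements b {1..int n})"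
proof (rule bij_betw_same_card)
  let ?f = "\<lambda>w. map w [1..<Suc n]" and ?g = "\<lambda>xs i. if i \<in> {1..n} then xs ! (i - 1) else 0"
  have asc: "ascending b xs \<longleftrightarrow> descD n w \<subseteq> pdesc b"
    if w: "w \<in> signed_perms n" and xs: "\<And>i. i \<in> {1..n} \<Longrightarrow> w i = xs ! (i - 1)" for w :: "nat \<Rightarrow> int" and xs
  proof -
    have "list_wext xs i = wext w i" if "i \<le> n" for i
      using xs[of 2] xs[of i] that assms(2) by (auto simp: list_wext_def wext_def)
    then have "list_wext xs i < list_wext xs (Suc i) \<longleftrightarrow> \<not> wext w i > wext w (Suc i)" if "i < n" for i
      using wext_neq[OF w assms(2) that] that by auto
    then show ?thesis by (auto simp: ascending_def descD_def assms(1))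
  qed
  show "bij_betw ?f {w \<in> signed_perms n. descD n w \<subseteq> pdesc b} (block_arrangements b {1..int n})"
  proof (rule bij_betw_byWitness[where f' = ?g])
    show "\<forall>w \<in> {w \<in> signed_perms n. descD n w \<subseteq> pdesc b}. ?g (?f w) = w"
    proof clarify
      fix w assume w: "w \<in> signed_perms n"
      show "?g (?f w) = w"
        using w by (intro ext) (auto simp: signed_perms_def simp del: upt_Suc)
    qed
    show "\<forall>xs \<in> block_arrangements b {1..int n}. ?f (?g xs) = xs"
      by (auto simp: block_arrangements_def assms(1) intro!: nth_equalityI simp del: upt_Suc)
    show "?f ` {w \<in> signed_perms n. descD n w \<subseteq> pdesc b} \<subseteq> block_arrangements b {1..int n}"
    proof clarify
      fix w assume w: "w \<in> signed_perms n" "descD n w \<subseteq> pdesc b"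
      then have bij: "bij_betw (\<lambda>i. nat \<bar>w i\<bar>) {1..n} {1..n}" by (simp add: signed_perms_def)
      have "inj_on (\<lambda>i. \<bar>w i\<bar>) {1..n}"
        using signed_perms_abs_neq[OF w(1)] by (meson inj_onI)
      then have "distinct (map abs (?f w))"
        by (simp add: distinct_map o_def atLeastLessThanSuc_atLeastAtMost del: upt_Suc)
      moreover have "abs ` set (?f w) = {1..int n}"
      proof -
        have "abs ` set (?f w) = int ` (\<lambda>i. nat \<bar>w i\<bar>) ` {1..n}"
          by (simp add: image_image atLeastLessThanSuc_atLeastAtMost del: upt_Suc)
        also have "(\<lambda>i. nat \<bar>w i\<bar>) ` {1..n} = {1..n}" using bij by (simp add: bij_betw_def)
        finally show ?thesis by (simp add: image_int_atLeastAtMost)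
      qed
      moreover have "ascending b (?f w)"
      proof -
        have "w i = ?f w ! (i - 1)" if "i \<in> {1..n}" for i
          using that by (cases i) (simp_all del: upt_Suc)
        then show ?thesis using asc[OF w(1)] w(2) by blast
      qed
      ultimately show "?f w \<in> block_arrangements b {1..int n}"
        by (simp add: block_arrangements_def assms(1) del: upt_Suc)
    qed
    show "?g ` block_arrangements b {1..int n} \<subseteq> {w \<in> signed_perms n. descD n w \<subseteq> pdesc b}"
    proof
      fix w assume "w \<in> ?g ` block_arrangements b {1..int n}"
      then obtain xs where xs: "xs \<in> block_arrangements b {1..int n}" and w: "w = ?g xs" by blast
      have len: "length xs = n" and d: "distinct (map abs xs)" and s: "abs ` set xs = {1..int n}"
        and a: "ascending b xs"
        using xs assms(1) by (auto simp: block_arrangements_def)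
      have "bij_betw (\<lambda>i. nat \<bar>w i\<bar>) {1..n} {1..n}"
      proof -
        have "(\<lambda>i. \<bar>w i\<bar>) ` {1..n} = abs ` set xs"
        proof -
          have "xs = ?f w" by (rule nth_equalityI) (simp_all add: len w del: upt_Suc)
          then have "set xs = w ` {1..n}" by (simp add: atLeastLessThanSuc_atLeastAtMost del: upt_Suc)
          then show ?thesis by (simp only: image_image)
        qed
        then have "nat ` (\<lambda>i. \<bar>w i\<bar>) ` {1..n} = nat ` int ` {1..n}"
          using s by (simp add: image_int_atLeastAtMost)
        then have im: "(\<lambda>i. nat \<bar>w i\<bar>) ` {1..n} = {1..n}" by (simp add: image_image)
        then show ?thesis by (simp add: bij_betw_def eq_card_imp_inj_on)
      qed
      then have "w \<in> signed_perms n" by (simp add: signed_perms_def w)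
      moreover have "descD n w \<subseteq> pdesc b"
        using asc[OF calculation, of xs] a by (simp add: w)
      ultimately show "w \<in> {w \<in> signed_perms n. descD n w \<subseteq> pdesc b}" by simp
    qed
  qed
qed

text \<open>Membership depends on absolute values only; this serves both sign changes below.\<close>

lemma signed_perms_uminus:
  assumes "w \<in> signed_perms n" "\<And>i. v i = w i \<or> v i = - w i"
  shows "v \<in> signed_perms n"
proof -
  have "\<bar>v i\<bar> = \<bar>w i\<bar>" for i using assms(2)[of i] by auto
  moreover have "w i = 0 \<Longrightarrow> v i = 0" for i using assms(2)[of i] by auto
  ultimately show ?thesis using assms(1) by (simp add: signed_perms_def)
qed

text \<open>Negating \<open>w 1\<close> is the diagram automorphism exchanging the nodes 0 and 1 of \<open>D\<^sub>n\<close>.\<close>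
lemma card_signed_perms_descD_swap:
  assumes "n \<ge> 2" "0 \<notin> S" "1 \<notin> S"
  shows "card {w \<in> signed_perms n. descD n w \<subseteq> insert 1 S} = card {w \<in> signed_perms n. descD n w \<subseteq> insert 0 S}"
proof (rule bij_betw_same_card)
  let ?f = "\<lambda>w :: nat \<Rightarrow> int. w(1 := - w 1)"
  let ?s = "\<lambda>i :: nat. if i = 0 then 1 else if i = 1 then 0 else i"
  \<comment> \<open>The test at 0 is \<open>- w 2 > w 1\<close>; after negating \<open>w 1\<close>
    it reads \<open>w 1 > w 2\<close>, the old test at 1, and conversely.\<close>
  have d: "i \<in> descD n (?f w) \<longleftrightarrow> ?s i \<in> descD n w" for i w
    using assms(1) by (auto simp: descD_def wext_def numeral_2_eq_2)
  have sw: "?f w \<in> signed_perms n" if "w \<in> signed_perms n" for w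
    by (rule signed_perms_uminus[OF that]) auto
  have *: "descD n (?f w) \<subseteq> insert (?s j) S" if "descD n w \<subseteq> insert j S" "j \<in> {0, 1}" for w j
    using that d[of _ w] assms(2,3) by (force split: if_splits)
  show "bij_betw ?f {w \<in> signed_perms n. descD n w \<subseteq> insert 1 S} {w \<in> signed_perms n. descD n w \<subseteq> insert 0 S}"
    using *[of _ 1] *[of _ 0] sw
    by (intro bij_betw_byWitness[where f' = ?f]) auto
qed

section \<open>The parity-reversing involution\<close>

definition flip_one :: "(nat \<Rightarrow> int) \<Rightarrow> nat \<Rightarrow> int" where
  "flip_one w i = (if \<bar>w i\<bar> = 1 then - w i else w i)"

lemma flip_one_flip_one: "flip_one (flip_one w) = w"
  by (rule ext) (simp add: flip_one_def)

lemma flip_one_signed_perms: "w \<in> signed_perms n \<Longrightarrow> flip_one w \<in> signed_perms n"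
  by (rule signed_perms_uminus[of w]) (auto simp: flip_one_def)

lemma descD_flip_one:
  assumes "w \<in> signed_perms n" "n \<ge> 2"
  shows "descD n (flip_one w) = descD n w"
proof -
  \<comment> \<open>If one of two nonzero numbers of different absolute value is 1 or -1, then the
    sign of the other one alone decides the comparison.\<close>
  have 1: "x > y \<longleftrightarrow> (if \<bar>x\<bar> = 1 then - x else x) > (if \<bar>y\<bar> = 1 then - y else y)"
    if "\<bar>x\<bar> \<noteq> \<bar>y\<bar>" "x \<noteq> 0" "y \<noteq> 0" for x y :: int
    using that by (auto simp: abs_if split: if_splits)
  \<comment> \<open>The conventional value at 0 is covered as well: \<open>- w 2\<close> is negated
    exactly when \<open>w 2\<close> is.\<close>
  have 2: "wext (flip_one w) i = (if \<bar>wext w i\<bar> = 1 then - wext w i else wext w i)" for i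
    by (auto simp: wext_def flip_one_def)
  have "\<bar>wext w i\<bar> \<noteq> \<bar>wext w (i + 1)\<bar>" "wext w i \<noteq> 0" "wext w (i + 1) \<noteq> 0" if "i < n" for i
    using that assms signed_perms_abs_neq[OF assms(1), of 2 1] signed_perms_abs_neq[OF assms(1), of i "i + 1"]
      signed_perms_nonzero[OF assms(1)] by (auto simp: wext_def)
  from 1[OF this] show ?thesis unfolding descD_def 2 by fastforce
qed

lemma even_flip_one:
  assumes "w \<in> signed_perms n" "n \<ge> 1"
  shows "even (card {i \<in> {1..n}. flip_one w i < 0}) \<longleftrightarrow> odd (card {i \<in> {1..n}. w i < 0})"
proof -
  have "1 \<in> (\<lambda>i. nat \<bar>w i\<bar>) ` {1..n}"
    using assms by (simp add: signed_perms_def bij_betw_def)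
  then obtain j where j: "j \<in> {1..n}" "\<bar>w j\<bar> = 1" by auto
  have un: "\<bar>w i\<bar> \<noteq> 1" if "i \<in> {1..n}" "i \<noteq> j" for i
    using signed_perms_abs_neq[OF assms(1) that(1) j(1) that(2)] j(2) by simp
  \<comment> \<open>The negative positions other than \<open>j\<close>; they are common to
    \<open>w\<close> and \<open>flip_one w\<close>, so the two counts differ by one.\<close>
  define R where "R = {i \<in> {1..n} - {j}. w i < 0}"
  have R: "finite R" "j \<notin> R" by (auto simp: R_def)
  have "{i \<in> {1..n}. w i < 0} = (if w j < 0 then insert j R else R)"
    using j by (auto simp: R_def)
  moreover have "{i \<in> {1..n}. flip_one w i < 0} = (if w j < 0 then R else insert j R)"
    using j un by (auto simp: R_def flip_one_def)
  ultimately show ?thesis using R by simp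
qed

lemma card_even_signed_perms_descD:
  assumes "n \<ge> 2"
  shows "2 * card {w \<in> even_signed_perms n. Q (descD n w)} = card {w \<in> signed_perms n. Q (descD n w)}"
proof -
  let ?E = "{w \<in> even_signed_perms n. Q (descD n w)}"
  let ?O = "{w \<in> signed_perms n. Q (descD n w)} - ?E"
  have "bij_betw flip_one ?E ?O"
    using assms even_flip_one[of _ n] descD_flip_one[of _ n] flip_one_signed_perms flip_one_flip_one
    by (intro bij_betw_byWitness[where f' = flip_one]) (auto simp: even_signed_perms_def)
  then have "card ?E = card ?O" by (rule bij_betw_same_card)
  moreover have "card {w \<in> signed_perms n. Q (descD n w)} = card ?E + card ?O"
  proof -
    have "?E \<union> ?O = {w \<in> signed_perms n. Q (descD n w)}" by (auto simp: even_signed_perms_def)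
    moreover have "finite ?E" "finite ?O" using finite_signed_perms by (simp_all add: even_signed_perms_def)
    ultimately show ?thesis using card_Un_disjoint[of ?E ?O] by (simp only: Diff_disjoint simp_thms)
  qed
  ultimately show ?thesis by simp
qed

section \<open>Pseudo-compositions\<close>

lemma pcomps_Cons_cases:
  assumes "b \<in> pcomps n"
  obtains x xs where "b = x # xs" "x + sum_list xs = n" "\<And>y. y \<in> set xs \<Longrightarrow> y > 0"
  using assms unfolding pcomps_def by (cases b) auto

lemma pdesc_hd_le: "xs \<noteq> [] \<Longrightarrow> i \<in> pdesc xs \<Longrightarrow> hd xs \<le> i"
proof (cases xs)
  case (Cons y ys)
  then show "i \<in> pdesc xs \<Longrightarrow> hd xs \<le> i"
    by (cases "ys = []") (auto simp: pdesc_Cons)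
qed simp

lemma pdesc_Suc_Cons: "pdesc (Suc c # xs) = Suc ` pdesc (c # xs)"
  by (cases "xs = []") (auto simp: pdesc_Cons image_image)

lemma sum_list_bprime: "sum_list (bprime b) = sum_list b"
  by (auto simp: bprime_def split: list.split nat.split)

lemma bprime_one: "bprime (Suc 0 # c # xs) = 0 # Suc c # xs"
  by (simp add: bprime_def)

lemma bprime_other: "hd b \<noteq> 1 \<Longrightarrow> bprime b = b"
  by (auto simp: bprime_def split: list.split nat.split)

text \<open>Passing to \<open>bprime\<close> exchanges 1 for 0 and keeps all other descents, which
  are at least 2 because \<open>c > 0\<close>. In this form
  \<open>card_signed_perms_descD_swap\<close> applies.\<close>

lemma pdesc_one_Cons:
  assumes "c > 0"
  obtains X where "pdesc (Suc 0 # c # xs) = insert 1 X" "pdesc (bprime (Suc 0 # c # xs)) = insert 0 X"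
    "0 \<notin> X" "1 \<notin> X"
proof
  have "0 \<notin> pdesc (c # xs)" using pdesc_hd_le[of "c # xs" 0] assms by auto
  then show "0 \<notin> Suc ` pdesc (c # xs)" "1 \<notin> Suc ` pdesc (c # xs)" by auto
  show "pdesc (Suc 0 # c # xs) = insert 1 (Suc ` pdesc (c # xs))"
    by (simp add: pdesc_Cons)
  show "pdesc (bprime (Suc 0 # c # xs)) = insert 0 (Suc ` pdesc (c # xs))"
    by (simp add: bprime_one pdesc_Cons pdesc_Suc_Cons)
qed

section \<open>Sizes of descent classes and their residues\<close>

text \<open>The factor 2 comes from passing to even permutations; it stays on the left and is
  inverted only modulo \<open>p\<close>.\<close>

lemma card_descD_le_1:
  assumes "b \<in> pcomps n" "n \<ge> 2" "hd b \<le> 1"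
  shows "2 * card {w \<in> even_signed_perms n. descD n w \<subseteq> pdesc b} = 2 ^ n * multinom n (bprime b)"
proof -
  obtain x xs where b: "b = x # xs" "x + sum_list xs = n" "\<And>y. y \<in> set xs \<Longrightarrow> y > 0"
    using pcomps_Cons_cases[OF assms(1)] by metis
  have zero: "card {w \<in> signed_perms n. descD n w \<subseteq> pdesc (0 # ys)} = 2 ^ n * multinom n (0 # ys)"
    if "sum_list ys = n" for ys
    using card_signed_perms_block[of "0 # ys" n] card_block_arrangements[of "{1..int n}" 0 ys] that assms(2)
    by simp
  have "card {w \<in> signed_perms n. descD n w \<subseteq> pdesc b} = 2 ^ n * multinom n (bprime b)"
  proof (cases "x = 0")
    case True
    then show ?thesis using zero[of xs] b by (simp add: bprime_other)
  next
    case False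
    then have x: "x = Suc 0" using assms(3) b(1) by simp
    \<comment> \<open>A second part exists because the first is 1 and the total is at least
      2.\<close>
    with b assms(2) obtain c ys where xs: "xs = c # ys" by (cases xs) auto
    with b have "c > 0" by simp
    then obtain X where X: "pdesc b = insert 1 X" "pdesc (bprime b) = insert 0 X" "0 \<notin> X" "1 \<notin> X"
      using pdesc_one_Cons[of c ys] b(1) x xs by metis
    have "card {w \<in> signed_perms n. descD n w \<subseteq> pdesc b} =
        card {w \<in> signed_perms n. descD n w \<subseteq> pdesc (bprime b)}"
      unfolding X(1,2) by (rule card_signed_perms_descD_swap[OF assms(2) X(3,4)])
    moreover have "bprime b = 0 # Suc c # ys" using b(1) x xs bprime_one by simp
    ultimately show ?thesis using zero[of "Suc c # ys"] b(2) x xs by simp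
  qed
  then show ?thesis
    using card_even_signed_perms_descD[OF assms(2), of "\<lambda>D. D \<subseteq> pdesc b"] by simp
qed

text \<open>The halving cancels against the free sign of the first entry, so only the entries after
  the first block contribute powers of 2.\<close>

lemma card_descD_gt_1:
  assumes "b \<in> pcomps n" "n \<ge> 2" "hd b > 1"
  shows "card {w \<in> even_signed_perms n. descD n w \<subseteq> pdesc b} = 2 ^ (n - hd b) * multinom n b"
proof -
  obtain x xs where b: "b = x # xs" "x + sum_list xs = n"
    using pcomps_Cons_cases[OF assms(1)] by metis
  have "2 * card {w \<in> even_signed_perms n. descD n w \<subseteq> pdesc b} = card (block_arrangements b {1..int n})"
    using card_even_signed_perms_descD[OF assms(2), of "\<lambda>D. D \<subseteq> pdesc b"]
      card_signed_perms_block[of b n] b assms(2) by simp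
  also have "\<dots> = 2 * 2 ^ sum_list xs * multinom n b"
    using card_block_arrangements[of "{1..int n}" x xs] b assms(3) by simp
  also have "sum_list xs = n - hd b" using b by auto
  finally show ?thesis by simp
qed

lemma nuD_eq_0:
  assumes "j \<le> k" "sum_list (map (digit p j) (bprime b)) \<noteq> digit p j n"
  shows "nuD p n k b = 0"
proof -
  have "multinom (digit p j n) (map (digit p j) (bprime b)) = 0"
    using assms(2) by (simp add: multinom_def)
  then have "\<exists>j\<in>{..k}. multinom (digit p j n) (map (digit p j) (bprime b)) = 0"
    using assms(1) by blast
  then show ?thesis by (auto simp: nuD_def Let_def)
qed

text \<open>Lucas treats the multinomial coefficient and Fermat the power of 2. For
  \<open>hd b > 1\<close> the exponent \<open>n - hd b\<close> has the expected digits only if the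
  parts add without carries; otherwise both sides vanish.\<close>

lemma card_descD_cong_nuD:
  assumes "prime p" "odd p" "n \<ge> 2" "n < p ^ (k + 1)" "b \<in> pcomps n"
  shows "[int (card {w \<in> even_signed_perms n. descD n w \<subseteq> pdesc b}) = nuD p n k b] (mod int p)"
proof -
  let ?G = "card {w \<in> even_signed_perms n. descD n w \<subseteq> pdesc b}"
  let ?M = "\<lambda>j. multinom (digit p j n) (map (digit p j) (bprime b))"
  have p0: "p > 0" using assms(1) prime_gt_0_nat by blast
  have sum: "sum_list (bprime b) = n" using assms(5) by (simp add: sum_list_bprime pcomps_def)
  have lucas: "[multinom n (bprime b) = (\<Prod>j\<le>k. ?M j)] (mod p)"
    by (rule lucas_multinom[OF assms(1,4) sum])
  have n: "(\<Sum>j\<le>k. digit p j n * p ^ j) = n" by (rule sum_digits[OF p0 assms(4)])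
  show ?thesis
  proof (cases "hd b \<le> 1")
    case True
    define N where "N = (\<Prod>j\<le>k. 2 ^ digit p j n * ?M j)"
    have "[2 ^ n = (\<Prod>j\<le>k. 2 ^ digit p j n)] (mod p)"
      using fermat_digit_power_cong[OF assms(1), of 2 "\<lambda>j. digit p j n" k] n by simp
    then have "[2 * ?G = N] (mod p)"
      unfolding card_descD_le_1[OF assms(5,3) True] N_def prod.distrib
      by (intro cong_mult lucas)
    \<comment> \<open>Since \<open>p\<close> is odd, \<open>(p + 1) div 2\<close> doubles to
      \<open>p + 1\<close>, which is 1 modulo \<open>p\<close>.\<close>
    moreover have "2 * ((p + 1) div 2) = p + 1" using assms(2) by simp
    then have "2 * ((p + 1) div 2 * N) = p * N + N" by (simp flip: mult.assoc)
    then have "[2 * ((p + 1) div 2 * N) = N] (mod p)" by (simp add: cong_def)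
    ultimately have "[2 * ?G = 2 * ((p + 1) div 2 * N)] (mod p)"
      by (meson cong_sym cong_trans)
    moreover have "coprime 2 p" using assms(2) by simp
    ultimately have "[?G = (p + 1) div 2 * N] (mod p)"
      by (simp only: cong_mult_lcancel_nat)
    then have "[int ?G = int ((p + 1) div 2 * N)] (mod int p)" by (simp only: cong_int_iff)
    moreover have "nuD p n k b = int ((p + 1) div 2 * N)"
      using True by (simp add: nuD_def Let_def N_def)
    ultimately show ?thesis by (simp only:)
  next
    case False
    then have bb: "bprime b = b" by (intro bprime_other) simp
    have b: "b \<noteq> []" using assms(5) by (simp add: pcomps_def)
    then have hd_in: "hd b \<in> set b" by simp
    have hd_le: "hd b \<le> n" using member_le_sum_list[OF hd_in] sum bb by simp
    let ?e = "\<lambda>j. digit p j n - digit p j (hd b)"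
    have "[2 ^ (n - hd b) * multinom n b = (\<Prod>j\<le>k. 2 ^ ?e j) * (\<Prod>j\<le>k. ?M j)] (mod p)"
    proof (cases "\<forall>j\<le>k. sum_list (map (digit p j) b) = digit p j n")
      case True
      \<comment> \<open>Without carries the digits of \<open>hd b\<close> are bounded by those of
        \<open>n\<close>, so the truncated differences \<open>?e j\<close> are true differences and
        expand \<open>n - hd b\<close>.\<close>
      have le: "digit p j (hd b) \<le> digit p j n" if "j \<le> k" for j
        using member_le_sum_list[of "digit p j (hd b)" "map (digit p j) b"] True that hd_in by auto
      have "(\<Sum>j\<le>k. ?e j * p ^ j) + (\<Sum>j\<le>k. digit p j (hd b) * p ^ j) = (\<Sum>j\<le>k. digit p j n * p ^ j)"
        unfolding sum.distrib[symmetric]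
        by (intro sum.cong refl) (use le in \<open>simp flip: add_mult_distrib\<close>)
      moreover have "(\<Sum>j\<le>k. digit p j (hd b) * p ^ j) = hd b"
        using hd_le assms(4) by (intro sum_digits p0) simp
      ultimately have "n - hd b = (\<Sum>j\<le>k. ?e j * p ^ j)" using n by simp
      then show ?thesis
        using fermat_digit_power_cong[OF assms(1), of 2 ?e k] lucas
        unfolding bb by (intro cong_mult) simp_all
    next
      case F: False
      then have "\<exists>j\<in>{..k}. ?M j = 0" by (auto simp: multinom_def bb)
      then have z: "(\<Prod>j\<le>k. ?M j) = 0" by simp
      have "[multinom n b = 0] (mod p)" using lucas unfolding z unfolding bb .
      then have "[2 ^ (n - hd b) * multinom n b = 2 ^ (n - hd b) * 0] (mod p)"
        by (intro cong_mult cong_refl)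
      then show ?thesis unfolding z by simp
    qed
    then have "[int ?G = int ((\<Prod>j\<le>k. 2 ^ ?e j) * (\<Prod>j\<le>k. ?M j))] (mod int p)"
      using card_descD_gt_1[OF assms(5,3)] False by (simp only: cong_int_iff not_le)
    moreover have "nuD p n k b = int ((\<Prod>j\<le>k. 2 ^ ?e j) * (\<Prod>j\<le>k. ?M j))"
      using False by (simp add: nuD_def Let_def bb prod.distrib)
    ultimately show ?thesis by (simp only:)
  qed
qed

section \<open>Pseudo-compositions as subsets of {0..<n}\<close>

lemma pcomps_snoc:
  assumes "b \<in> pcomps m" "m < n"
  shows "b @ [n - m] \<in> pcomps n"
  using assms by (cases b) (auto simp: pcomps_def)

lemma pdesc_less:
  assumes "b \<in> pcomps n" "i \<in> pdesc b"
  shows "i < n"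
proof -
  obtain j where j: "1 \<le> j" "j < length b" "i = sum_list (take j b)"
    using assms(2) by (auto simp: pdesc_def)
  have "b ! j \<in> set (tl b)" using j by (cases b) (auto simp: nth_Cons')
  then have "b ! j > 0" using assms(1) by (auto simp: pcomps_def)
  moreover have "b = take j b @ b ! j # drop (Suc j) b" using j by (simp add: id_take_nth_drop)
  then have "sum_list b = i + (b ! j + sum_list (drop (Suc j) b))"
    using j(3) by (metis sum_list.Cons sum_list_append)
  moreover have "sum_list b = n" using assms(1) by (simp add: pcomps_def)
  ultimately show ?thesis by simp
qed

lemma pcomps_rev_cases:
  assumes "b \<in> pcomps n"
  obtains "b = [n]" "pdesc b = {}"
    | a m where "a \<in> pcomps m" "m < n" "b = a @ [n - m]" "pdesc b = insert m (pdesc a)"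
proof (cases b rule: rev_cases)
  case (snoc a c)
  show ?thesis
  proof (cases "a = []")
    case True
    then show ?thesis using that(1) snoc assms by (simp add: pcomps_def)
  next
    case False
    then have "c > 0" "sum_list a + c = n" "a \<in> pcomps (sum_list a)"
      using assms snoc by (auto simp: pcomps_def)
    then show ?thesis using that(2)[of a "sum_list a"] snoc False by (auto simp: pdesc_snoc)
  qed
qed (use assms in \<open>simp add: pcomps_def\<close>)

lemma Max_insert_pdesc: "a \<in> pcomps m \<Longrightarrow> Max (insert m (pdesc a)) = m"
proof -
  assume "a \<in> pcomps m"
  then have "pdesc a \<subseteq> {..<m}" using pdesc_less by blast
  then show ?thesis by (intro Max_eqI) (auto intro: finite_subset)
qed

text \<open>The largest element of \<open>pdesc b\<close> is the sum of all parts but the last. It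
  determines the last part, and the rest is a smaller instance.\<close>

lemma inj_on_pdesc: "inj_on pdesc (pcomps n)"
proof -
  have "b \<in> pcomps n \<Longrightarrow> b' \<in> pcomps n \<Longrightarrow> pdesc b = pdesc b' \<Longrightarrow> b = b'" for b b'
  proof (induction n arbitrary: b b' rule: less_induct)
    case (less n)
    show ?case
    proof (cases rule: pcomps_rev_cases[OF less.prems(1)])
      case 1
      then show ?thesis
        using less.prems(3) by (cases rule: pcomps_rev_cases[OF less.prems(2)]) auto
    next
      case (2 a m)
      show ?thesis
      proof (cases rule: pcomps_rev_cases[OF less.prems(2)])
        case 1
        then show ?thesis using 2 less.prems(3) by auto
      next
        case B: (2 a' m')
        then have "insert m (pdesc a) = insert m' (pdesc a')" using 2 less.prems(3) by simp
        moreover from this have "m = m'" using Max_insert_pdesc 2 B by metis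
        moreover have "m \<notin> pdesc a" "m' \<notin> pdesc a'" using pdesc_less 2 B by blast+
        ultimately have "pdesc a = pdesc a'" by (metis insert_ident)
        then have "a = a'" using less.IH[of m a a'] 2 B \<open>m = m'\<close> by blast
        then show ?thesis using 2 B \<open>m = m'\<close> by simp
      qed
    qed
  qed
  then show ?thesis by (auto simp: inj_on_def)
qed

text \<open>The last part is \<open>n - Max S\<close>, and recursion handles the smaller elements. A
  maximum of 0 leads to the pseudo-composition \<open>[0]\<close> of 0, which supplies the leading
  part 0.\<close>

lemma ex_pcomps_pdesc: "S \<subseteq> {0..<n} \<Longrightarrow> \<exists>b\<in>pcomps n. pdesc b = S"
proof (induction n arbitrary: S rule: less_induct)
  case (less n)
  show ?case
  proof (cases "S = {}")
    case True
    then show ?thesis by (intro bexI[of _ "[n]"]) (auto simp: pcomps_def)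
  next
    case False
    have fin: "finite S" using less.prems finite_subset by blast
    define m where "m = Max S"
    have m: "m \<in> S" "m < n" using fin False less.prems by (auto simp: m_def)
    have "S - {m} \<subseteq> {0..<m}"
      using fin Max_ge[of S] unfolding m_def by fastforce
    then obtain a where a: "a \<in> pcomps m" "pdesc a = S - {m}" using less.IH[OF m(2)] by blast
    then have "pdesc (a @ [n - m]) = S" using m(1) by (auto simp: pdesc_snoc pcomps_def)
    then show ?thesis using pcomps_snoc[OF a(1) m(2)] by blast
  qed
qed

lemma bij_betw_pdesc: "bij_betw pdesc (pcomps n) (Pow {0..<n})"
proof -
  have "pdesc b \<in> Pow {0..<n}" if "b \<in> pcomps n" for b
    using pdesc_less[OF that] by auto
  moreover have "S \<in> pdesc ` pcomps n" if "S \<in> Pow {0..<n}" for S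
    using ex_pcomps_pdesc[of S n] that by blast
  ultimately have "pdesc ` pcomps n = Pow {0..<n}" by blast
  then show ?thesis using inj_on_pdesc by (simp add: bij_betw_def)
qed

section \<open>Ribbon numbers modulo a prime\<close>

text \<open>Moebius inversion over the subsets of \<open>pdesc a\<close>, each of which is
  \<open>pdesc b\<close> for a unique \<open>b\<close>.\<close>

lemma ribbonD_mobius:
  assumes "a \<in> pcomps n"
  shows "int (ribbonD n a) = (\<Sum>b\<in>{b \<in> pcomps n. pdesc b \<subseteq> pdesc a}.
    (-1) ^ (card (pdesc a) - card (pdesc b)) * int (card {w \<in> even_signed_perms n. descD n w \<subseteq> pdesc b}))"
proof -
  let ?f = "\<lambda>S. int (card {w \<in> even_signed_perms n. descD n w = S})"
  let ?g = "\<lambda>S. int (card {w \<in> even_signed_perms n. descD n w \<subseteq> S})"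
  have fin: "finite (even_signed_perms n)"
    using finite_signed_perms by (simp add: even_signed_perms_def)
  have S: "pdesc a \<subseteq> {0..<n}" using pdesc_less[OF assms] by auto
  have "?g S = sum ?f (Pow S)" if "finite S" for S
  proof -
    have "{w \<in> even_signed_perms n. descD n w \<subseteq> S} =
        (\<Union>T\<in>Pow S. {w \<in> even_signed_perms n. descD n w = T})" by auto
    then have "card {w \<in> even_signed_perms n. descD n w \<subseteq> S} =
        (\<Sum>T\<in>Pow S. card {w \<in> even_signed_perms n. descD n w = T})"
      using fin that by (simp only:) (intro card_UN_disjoint, auto)
    then show ?thesis by simp
  qed
  moreover have "finite (pdesc a)" using S finite_subset by blast
  ultimately have "?f (pdesc a) = (\<Sum>T \<in> Pow (pdesc a). (-1) ^ (card (pdesc a) - card T) * ?g T)"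
    by (rule inclusion_exclusion_mobius)
  also have "\<dots> = (\<Sum>b\<in>{b \<in> pcomps n. pdesc b \<subseteq> pdesc a}. (-1) ^ (card (pdesc a) - card (pdesc b)) * ?g (pdesc b))"
  proof (rule sum.reindex_bij_betw[symmetric])
    show "bij_betw pdesc {b \<in> pcomps n. pdesc b \<subseteq> pdesc a} (Pow (pdesc a))"
    proof (rule bij_betw_subset[OF bij_betw_pdesc])
      show "pdesc ` {b \<in> pcomps n. pdesc b \<subseteq> pdesc a} = Pow (pdesc a)"
        using ex_pcomps_pdesc[of _ n] S by (auto simp: image_iff)
    qed auto
  qed
  finally show ?thesis by (simp add: ribbonD_def)
qed

section \<open>Reduction to descents in P\<close>

text \<open>By Lucas, for prime \<open>p\<close> and \<open>n < p ^ (k + 1)\<close> these are the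
  \<open>m\<close> for which \<open>n choose m\<close> is not divisible by \<open>p\<close>.\<close>

definition digit_dominated :: "nat \<Rightarrow> nat \<Rightarrow> nat \<Rightarrow> nat set" where
  "digit_dominated p n k = {\<Sum>j\<le>k. bb j * p ^ j | bb. \<forall>j\<le>k. bb j \<le> digit p j n}"

lemma Pset_eq: "Pset p n k = insert 1 (digit_dominated p n k) - {n}"
  by (simp add: Pset_def digit_dominated_def)

lemma sum_list_digits:
  assumes "p > 0" "\<forall>m\<in>set ms. m < p ^ (k + 1)"
  shows "sum_list ms = (\<Sum>j\<le>k. sum_list (map (digit p j) ms) * p ^ j)"
  using assms(2)
proof (induction ms)
  case (Cons m ms)
  then show ?case using sum_digits[OF assms(1), of m k]
    by (simp add: add_mult_distrib sum.distrib)
qed simp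

text \<open>A descent is a sum of initial parts; its coefficients at the powers of \<open>p\<close>
  are partial sums of the digit columns, and full columns sum to the digits of
  \<open>n\<close>.\<close>

lemma pdesc_subset_digit_dominated:
  assumes "p > 0" "n < p ^ (k + 1)" "sum_list b = n"
    and "\<forall>j\<le>k. sum_list (map (digit p j) b) = digit p j n"
  shows "pdesc b \<subseteq> digit_dominated p n k"
proof
  fix i assume "i \<in> pdesc b"
  then obtain l where i: "i = sum_list (take l b)" by (auto simp: pdesc_def)
  have "m < p ^ (k + 1)" if "m \<in> set b" for m
    using member_le_sum_list[OF that] assms(2,3) by simp
  then have "\<forall>m\<in>set (take l b). m < p ^ (k + 1)" by (meson in_set_takeD)
  then have "i = (\<Sum>j\<le>k. sum_list (map (digit p j) (take l b)) * p ^ j)"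
    unfolding i by (rule sum_list_digits[OF assms(1)])
  moreover have "sum_list (map (digit p j) (take l b)) \<le> digit p j n" if "j \<le> k" for j
  proof -
    have "sum_list (map (digit p j) b) =
        sum_list (map (digit p j) (take l b)) + sum_list (map (digit p j) (drop l b))"
      by (metis append_take_drop_id map_append sum_list_append)
    then show ?thesis using assms(4) that by simp
  qed
  ultimately show "i \<in> digit_dominated p n k"
    unfolding digit_dominated_def mem_Collect_eq
    by (intro exI[of _ "\<lambda>j. sum_list (map (digit p j) (take l b))"]) simp
qed

text \<open>The digit condition concerns \<open>bprime b\<close>, so it controls
  \<open>pdesc (bprime b)\<close>; the descents of \<open>b\<close> itself may include 1 in
  addition.\<close>

lemma pdesc_subset_Pset:
  assumes "p > 0" "n < p ^ (k + 1)" "n \<ge> 2" "b \<in> pcomps n"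
    and "\<forall>j\<le>k. sum_list (map (digit p j) (bprime b)) = digit p j n"
  shows "pdesc b \<subseteq> Pset p n k"
proof -
  have "pdesc (bprime b) \<subseteq> digit_dominated p n k"
    using assms by (intro pdesc_subset_digit_dominated) (auto simp: sum_list_bprime pcomps_def)
  moreover have "pdesc b \<subseteq> insert 1 (pdesc (bprime b))"
  proof (cases "hd b = 1")
    case True
    obtain x xs where b: "b = x # xs" "x + sum_list xs = n" "\<And>y. y \<in> set xs \<Longrightarrow> y > 0"
      using pcomps_Cons_cases[OF assms(4)] by metis
    with True assms(3) obtain c ys where "xs = c # ys" by (cases xs) auto
    then have e: "b = Suc 0 # c # ys" "c > 0" using b True by auto
    show ?thesis unfolding e(1) by (rule pdesc_one_Cons[OF e(2), of ys]) auto
  qed (auto simp: bprime_other)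
  moreover have "n \<notin> pdesc b" using pdesc_less[OF assms(4)] by blast
  ultimately show ?thesis unfolding Pset_eq by blast
qed

lemma ribbonD_cong_rD:
  assumes "prime p" "odd p" "n \<ge> 2" "n < p ^ (k + 1)" "a \<in> pcomps n"
  shows "[int (ribbonD n a) =
    (-1) ^ card (pdesc a - Pset p n k) * rD p n k (pdesc a \<inter> Pset p n k)] (mod int p)"
proof -
  let ?S = "pdesc a" and ?P = "Pset p n k"
  let ?dig = "\<lambda>b. \<forall>j\<le>k. sum_list (map (digit p j) (bprime b)) = digit p j n"
  have p0: "p > 0" using assms(1) prime_gt_0_nat by blast
  have finS: "finite ?S" using pdesc_less[OF assms(5)] by (intro finite_subset[of ?S "{0..<n}"]) auto
  have fin: "finite (pcomps n)" using bij_betw_finite[OF bij_betw_pdesc] by simp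
  have "[int (ribbonD n a) = (\<Sum>b\<in>{b \<in> pcomps n. pdesc b \<subseteq> ?S}.
      (-1) ^ (card ?S - card (pdesc b)) * nuD p n k b)] (mod int p)"
    unfolding ribbonD_mobius[OF assms(5)]
    by (intro cong_sum cong_mult cong_refl card_descD_cong_nuD assms(1-4)) auto
  also have "(\<Sum>b\<in>{b \<in> pcomps n. pdesc b \<subseteq> ?S}. (-1) ^ (card ?S - card (pdesc b)) * nuD p n k b) =
    (\<Sum>b\<in>{b \<in> pcomps n. pdesc b \<subseteq> ?S \<inter> ?P \<and> ?dig b}. (-1) ^ (card ?S - card (pdesc b)) * nuD p n k b)"
  proof (rule sum.mono_neutral_right)
    \<comment> \<open>A carry kills \<open>nuD\<close>, and a descent outside \<open>P\<close>
      forces a carry.\<close>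
    have "nuD p n k b = 0" if "b \<in> pcomps n" "\<not> pdesc b \<subseteq> ?P \<or> \<not> ?dig b" for b
      using nuD_eq_0 pdesc_subset_Pset[OF p0 assms(4,3) that(1)] that(2) by blast
    then show "\<forall>b\<in>{b \<in> pcomps n. pdesc b \<subseteq> ?S} - {b \<in> pcomps n. pdesc b \<subseteq> ?S \<inter> ?P \<and> ?dig b}.
        (-1) ^ (card ?S - card (pdesc b)) * nuD p n k b = 0"
      by simp
  qed (use fin in auto)
  also have "\<dots> = (\<Sum>b\<in>{b \<in> pcomps n. pdesc b \<subseteq> ?S \<inter> ?P \<and> ?dig b}.
     (-1) ^ card (?S - ?P) * ((-1) ^ (card (?S \<inter> ?P) - card (pdesc b)) * nuD p n k b))"
  proof (rule sum.cong[OF refl])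
    fix b assume "b \<in> {b \<in> pcomps n. pdesc b \<subseteq> ?S \<inter> ?P \<and> ?dig b}"
    \<comment> \<open>Needed because the exponents are truncated differences: only then does the
      sign of the elements outside \<open>P\<close> split off.\<close>
    then have "card (pdesc b) \<le> card (?S \<inter> ?P)" using finS by (auto intro: card_mono)
    moreover have "card ?S = card (?S - ?P) + card (?S \<inter> ?P)"
      using card_Int_Diff[OF finS, of ?P] by simp
    ultimately have "card ?S - card (pdesc b) = card (?S - ?P) + (card (?S \<inter> ?P) - card (pdesc b))" by simp
    then show "(-1) ^ (card ?S - card (pdesc b)) * nuD p n k b =
      (-1) ^ card (?S - ?P) * ((-1) ^ (card (?S \<inter> ?P) - card (pdesc b)) * nuD p n k b)"
      by (simp add: power_add)
  qed
  also have "\<dots> = (-1) ^ card (?S - ?P) * rD p n k (?S \<inter> ?P)"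
    unfolding rD_def sum_distrib_left ..
  finally show ?thesis .
qed

lemma cD_eq_card_subsets:
  assumes "prime p" "odd p" "n \<ge> 2" "n < p ^ (k + 1)"
  shows "cD p i n = card {S. S \<subseteq> {0..<n} \<and>
    [(-1) ^ card (S - Pset p n k) * rD p n k (S \<inter> Pset p n k) = i] (mod int p)}"
  unfolding cD_def
proof (rule bij_betw_same_card, rule bij_betw_subset[OF bij_betw_pdesc])
  have *: "[int (ribbonD n a) = i] (mod int p) \<longleftrightarrow>
      [(-1) ^ card (pdesc a - Pset p n k) * rD p n k (pdesc a \<inter> Pset p n k) = i] (mod int p)"
    if "a \<in> pcomps n" for a
    using ribbonD_cong_rD[OF assms that] by (meson cong_sym cong_trans)
  show "pdesc ` {a \<in> pcomps n. [int (ribbonD n a) = i] (mod int p)} = {S. S \<subseteq> {0..<n} \<and>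
    [(-1) ^ card (S - Pset p n k) * rD p n k (S \<inter> Pset p n k) = i] (mod int p)}"
  proof (intro equalityI subsetI)
    fix S assume "S \<in> pdesc ` {a \<in> pcomps n. [int (ribbonD n a) = i] (mod int p)}"
    then obtain a where a: "a \<in> pcomps n" "S = pdesc a" "[int (ribbonD n a) = i] (mod int p)" by blast
    then have "S \<subseteq> {0..<n}" using pdesc_less[OF a(1)] by auto
    with a *[OF a(1)] show "S \<in> {S. S \<subseteq> {0..<n} \<and>
      [(-1) ^ card (S - Pset p n k) * rD p n k (S \<inter> Pset p n k) = i] (mod int p)}" by simp
  next
    fix S assume S: "S \<in> {S. S \<subseteq> {0..<n} \<and>
      [(-1) ^ card (S - Pset p n k) * rD p n k (S \<inter> Pset p n k) = i] (mod int p)}"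
    then obtain a where a: "a \<in> pcomps n" "pdesc a = S" using ex_pcomps_pdesc by blast
    show "S \<in> pdesc ` {a \<in> pcomps n. [int (ribbonD n a) = i] (mod int p)}"
      using S *[OF a(1)] a by (intro image_eqI[of _ _ a]) auto
  qed
qed auto

section \<open>Equidistribution of the sign\<close>

lemma card_even_odd_subsets:
  assumes "finite Q" "Q \<noteq> {}"
  shows "card {U. U \<subseteq> Q \<and> even (card U)} = 2 ^ (card Q - 1)" "card {U. U \<subseteq> Q \<and> odd (card U)} = 2 ^ (card Q - 1)"
proof -
  have eq: "card {U. U \<subseteq> Q \<and> even (card U)} = card {U. U \<subseteq> Q \<and> odd (card U)}"
    using card_subsupersets_even_odd[of Q "{}"] assms by auto
  have "card (Pow Q) = card ({U. U \<subseteq> Q \<and> even (card U)} \<union> {U. U \<subseteq> Q \<and> odd (card U)})"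
    by (rule arg_cong[of _ _ card]) auto
  also have "\<dots> = card {U. U \<subseteq> Q \<and> even (card U)} + card {U. U \<subseteq> Q \<and> odd (card U)}"
    using assms(1) by (intro card_Un_disjoint) auto
  finally have "2 ^ card Q = 2 * card {U. U \<subseteq> Q \<and> odd (card U)}"
    using eq assms(1) by (simp add: card_Pow)
  moreover have "card Q = Suc (card Q - 1)" using assms by (simp add: card_gt_0_iff)
  ultimately have "2 * 2 ^ (card Q - 1) = 2 * card {U. U \<subseteq> Q \<and> odd (card U)}"
    by (metis power_Suc)
  with eq show "card {U. U \<subseteq> Q \<and> even (card U)} = 2 ^ (card Q - 1)" "card {U. U \<subseteq> Q \<and> odd (card U)} = 2 ^ (card Q - 1)"
    by simp_all
qed

text \<open>Split \<open>S\<close> into a part in \<open>Q\<close>, which only matters through its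
  parity, and a part in \<open>P\<close>, which must hit \<open>i\<close> or \<open>- i\<close>
  accordingly. As \<open>Q\<close> is nonempty, each parity has half of its subsets.\<close>

lemma card_signed_residue_subsets:
  fixes r :: "nat set \<Rightarrow> int"
  assumes "finite P" "finite Q" "P \<inter> Q = {}" "Q \<noteq> {}"
  shows "card {S. S \<subseteq> P \<union> Q \<and> [(-1) ^ card (S - P) * r (S \<inter> P) = i] (mod m)} =
    2 ^ (card Q - 1) * (card {T. T \<subseteq> P \<and> [r T = i] (mod m)} + card {T. T \<subseteq> P \<and> [r T = - i] (mod m)})"
proof -
  let ?A = "\<lambda>s. {T. T \<subseteq> P \<and> [r T = s] (mod m)}"
  let ?U = "\<lambda>U. if even (card U) then ?A i else ?A (- i)"
  have mem: "[(-1) ^ card U * r T = i] (mod m) \<longleftrightarrow> [r T = (if even (card U) then i else - i)] (mod m)" for U T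
    using cong_minus_minus_iff[of "r T" "- i" m] by simp
  have "bij_betw (\<lambda>S. (S - P, S \<inter> P)) {S. S \<subseteq> P \<union> Q \<and> [(-1) ^ card (S - P) * r (S \<inter> P) = i] (mod m)}
     (SIGMA U:Pow Q. ?U U)"
  proof (rule bij_betw_byWitness[where f' = "\<lambda>(U, T). U \<union> T"])
    show "(\<lambda>(U, T). U \<union> T) ` (SIGMA U:Pow Q. ?U U) \<subseteq>
        {S. S \<subseteq> P \<union> Q \<and> [(-1) ^ card (S - P) * r (S \<inter> P) = i] (mod m)}"
    proof clarify
      fix U T assume U: "U \<subseteq> Q" and T: "T \<in> ?U U"
      have "T \<subseteq> P" "[r T = (if even (card U) then i else - i)] (mod m)" using T by (auto split: if_splits)
      moreover from this U assms(3) have "(U \<union> T) - P = U" "(U \<union> T) \<inter> P = T" by auto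
      ultimately show "U \<union> T \<subseteq> P \<union> Q \<and> [(-1) ^ card (U \<union> T - P) * r ((U \<union> T) \<inter> P) = i] (mod m)"
        using U mem[of U T] by auto
    qed
    show "\<forall>x \<in> (SIGMA U:Pow Q. ?U U). ((case x of (U, T) \<Rightarrow> U \<union> T) - P, (case x of (U, T) \<Rightarrow> U \<union> T) \<inter> P) = x"
      using assms(3) by (auto split: if_splits)
    show "(\<lambda>S. (S - P, S \<inter> P)) ` {S. S \<subseteq> P \<union> Q \<and> [(-1) ^ card (S - P) * r (S \<inter> P) = i] (mod m)} \<subseteq>
        (SIGMA U:Pow Q. ?U U)"
    proof clarify
      fix S assume S: "S \<subseteq> P \<union> Q" "[(-1) ^ card (S - P) * r (S \<inter> P) = i] (mod m)"
      show "S - P \<in> Pow Q \<and> S \<inter> P \<in> ?U (S - P)"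
        using S(1) S(2)[unfolded mem] by auto
    qed
  qed auto
  then have "card {S. S \<subseteq> P \<union> Q \<and> [(-1) ^ card (S - P) * r (S \<inter> P) = i] (mod m)} = card (SIGMA U:Pow Q. ?U U)"
    by (rule bij_betw_same_card)
  also have "\<dots> = (\<Sum>U\<in>Pow Q. card (?U U))"
    using assms(1,2) by (intro card_SigmaI) auto
  also have "\<dots> = (\<Sum>U\<in>Pow Q. if even (card U) then card (?A i) else card (?A (- i)))"
    by (rule sum.cong) simp_all
  also have "\<dots> = (\<Sum>U\<in>Pow Q \<inter> {U. even (card U)}. card (?A i)) +
      (\<Sum>U\<in>Pow Q \<inter> - {U. even (card U)}. card (?A (- i)))"
    using assms(2) by (intro sum.If_cases) simp
  also have "Pow Q \<inter> {U. even (card U)} = {U. U \<subseteq> Q \<and> even (card U)}" by auto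
  also have "Pow Q \<inter> - {U. even (card U)} = {U. U \<subseteq> Q \<and> odd (card U)}" by auto
  finally show ?thesis
    using card_even_odd_subsets[OF assms(2,4)] by (simp add: algebra_simps)
qed

section \<open>Base-p expansions and the size of P\<close>

lemma sum_digit_less:
  fixes p :: nat
  assumes "\<forall>j\<le>k. e j < p"
  shows "(\<Sum>j\<le>k. e j * p ^ j) < p ^ (k + 1)"
  using assms
proof (induction k)
  case (Suc k)
  then have "(\<Sum>j\<le>k. e j * p ^ j) < p ^ (k + 1)" "Suc (e (Suc k)) \<le> p" by (auto simp: Suc_le_eq)
  moreover from this(2) have "Suc (e (Suc k)) * p ^ (k + 1) \<le> p * p ^ (k + 1)" by (rule mult_le_mono1)
  ultimately show ?case by simp
qed simp

lemma digit_sum: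
  assumes "\<forall>j\<le>k. e j < p" "i \<le> k"
  shows "digit p i (\<Sum>j\<le>k. e j * p ^ j) = e i"
  using assms
proof (induction k)
  case (Suc k)
  let ?s = "\<Sum>j\<le>k. e j * p ^ j"
  have p0: "p > 0" using Suc.prems by force
  have s: "?s < p ^ Suc k" using sum_digit_less[of k e p] Suc.prems by simp
  show ?case
  proof (cases "i = Suc k")
    case True
    then show ?thesis using s p0 Suc.prems by (simp add: digit_def)
  next
    case False
    then have "i \<le> k" using Suc.prems by simp
    \<comment> \<open>The exponent gap is written as \<open>Suc d\<close> so that the top term,
      divided by \<open>p ^ i\<close>, visibly keeps a factor \<open>p\<close> and disappears modulo
      \<open>p\<close>.\<close>
    then obtain d where d: "Suc k = i + Suc d" by (metis add_Suc_right le_Suc_ex)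
    have "(?s + e (Suc k) * p ^ Suc k) div p ^ i = ?s div p ^ i + e (Suc k) * p ^ Suc d"
    proof -
      have "e (Suc k) * p ^ Suc k = (e (Suc k) * p ^ Suc d) * p ^ i"
        unfolding d power_add by (simp add: ac_simps)
      then have "(?s + e (Suc k) * p ^ Suc k) div p ^ i = (?s + (e (Suc k) * p ^ Suc d) * p ^ i) div p ^ i"
        by (simp only:)
      also have "\<dots> = e (Suc k) * p ^ Suc d + ?s div p ^ i" by (rule div_mult_self1) (use p0 in simp)
      finally show ?thesis by (simp only: add.commute)
    qed
    then have "digit p i (?s + e (Suc k) * p ^ Suc k) = (?s div p ^ i + p * (e (Suc k) * p ^ d)) mod p"
      by (simp add: digit_def mult.left_commute)
    also have "\<dots> = digit p i ?s" by (simp add: digit_def)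
    finally show ?thesis using Suc \<open>i \<le> k\<close> by simp
  qed
qed (simp add: digit_def)

lemma digit_dominated_iff:
  assumes "p > 0"
  shows "m \<in> digit_dominated p n k \<longleftrightarrow> m < p ^ (k + 1) \<and> (\<forall>j\<le>k. digit p j m \<le> digit p j n)"
proof
  assume "m \<in> digit_dominated p n k"
  then obtain e where e: "m = (\<Sum>j\<le>k. e j * p ^ j)" "\<forall>j\<le>k. e j \<le> digit p j n"
    unfolding digit_dominated_def by blast
  have "digit p j n < p" for j using assms by (simp add: digit_def)
  with e(2) have "\<forall>j\<le>k. e j < p" using le_less_trans by blast
  then show "m < p ^ (k + 1) \<and> (\<forall>j\<le>k. digit p j m \<le> digit p j n)"
    using e sum_digit_less[of k e p] digit_sum[of k e p] by simp
next
  assume "m < p ^ (k + 1) \<and> (\<forall>j\<le>k. digit p j m \<le> digit p j n)"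
  then show "m \<in> digit_dominated p n k"
    using sum_digits[OF assms, of m k] unfolding digit_dominated_def mem_Collect_eq
    by (intro exI[of _ "\<lambda>j. digit p j m"]) simp
qed

lemma card_digit_dominated:
  assumes "p > 0"
  shows "card (digit_dominated p n k) = (\<Prod>j\<le>k. digit p j n + 1)"
proof -
  \<comment> \<open>Extensional functions, since the values of \<open>bb\<close> beyond
    \<open>k\<close> are unconstrained and would spoil injectivity.\<close>
  let ?E = "\<Pi>\<^sub>E j\<in>{..k}. {..digit p j n}"
  have "bij_betw (\<lambda>e. \<Sum>j\<le>k. e j * p ^ j) ?E (digit_dominated p n k)"
  proof (rule bij_betwI')
    fix e e' assume e: "e \<in> ?E" "e' \<in> ?E"
    have lt: "\<forall>j\<le>k. f j < p" if "f \<in> ?E" for f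
    proof (intro allI impI)
      fix j assume "j \<le> k"
      then have "f j \<le> digit p j n" using that by (auto simp: PiE_iff)
      also have "\<dots> < p" using assms by (simp add: digit_def)
      finally show "f j < p" .
    qed
    show "(\<Sum>j\<le>k. e j * p ^ j) = (\<Sum>j\<le>k. e' j * p ^ j) \<longleftrightarrow> e = e'"
    proof
      assume eq: "(\<Sum>j\<le>k. e j * p ^ j) = (\<Sum>j\<le>k. e' j * p ^ j)"
      show "e = e'"
      proof (rule PiE_ext[OF e])
        fix j assume "j \<in> {..k}"
        then have "j \<le> k" by simp
        show "e j = e' j"
          using digit_sum[OF lt[OF e(1)] \<open>j \<le> k\<close>] digit_sum[OF lt[OF e(2)] \<open>j \<le> k\<close>] eq by simp
      qed
    qed simp
  next
    fix e assume "e \<in> ?E"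
    then show "(\<Sum>j\<le>k. e j * p ^ j) \<in> digit_dominated p n k"
      unfolding digit_dominated_def by (auto simp: PiE_iff)
  next
    fix m assume "m \<in> digit_dominated p n k"
    then obtain e where e: "m = (\<Sum>j\<le>k. e j * p ^ j)" "\<forall>j\<le>k. e j \<le> digit p j n"
      unfolding digit_dominated_def by blast
    have "restrict e {..k} \<in> ?E" using e(2) by auto
    moreover have "m = (\<Sum>j\<le>k. restrict e {..k} j * p ^ j)" using e(1) by simp
    ultimately show "\<exists>e\<in>?E. m = (\<Sum>j\<le>k. e j * p ^ j)" by blast
  qed
  then have "card (digit_dominated p n k) = card ?E" using bij_betw_same_card by metis
  then show ?thesis by (simp add: card_PiE)
qed

lemma finite_digit_dominated: "p > 0 \<Longrightarrow> finite (digit_dominated p n k)"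
  by (rule finite_subset[of _ "{..<p ^ (k + 1)}"]) (auto simp: digit_dominated_iff)

lemma one_in_digit_dominated:
  assumes "p > 1"
  shows "1 \<in> digit_dominated p n k \<longleftrightarrow> digit p 0 n > 0"
proof -
  have "digit p j 1 = (if j = 0 then 1 else 0)" for j
  proof (cases "j = 0")
    case False
    then have "1 < p ^ j" using assms by (intro one_less_power) simp_all
    then show ?thesis using False by (simp add: digit_def)
  qed (use assms in \<open>simp add: digit_def\<close>)
  moreover have "1 < p ^ (k + 1)" using assms by (intro one_less_power) simp_all
  ultimately show ?thesis using assms by (auto simp: digit_dominated_iff Suc_le_eq)
qed

text \<open>\<open>n\<close> is dominated by itself and always removed. Adjoining 1 compensates for
  this exactly when 1 is not dominated already, that is when the lowest digit of \<open>n\<close> is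
  0.\<close>

lemma card_Pset:
  assumes "p > 1" "n \<ge> 2" "n < p ^ (k + 1)"
  shows "card (Pset p n k) = (if digit p 0 n = 0 then (\<Prod>j\<le>k. digit p j n + 1)
            else (\<Prod>j\<le>k. digit p j n + 1) - 1)"
proof -
  have fin: "finite (digit_dominated p n k)" using assms(1) by (intro finite_digit_dominated) simp
  have "n \<in> digit_dominated p n k" using assms by (simp add: digit_dominated_iff)
  moreover have "card (digit_dominated p n k) = (\<Prod>j\<le>k. digit p j n + 1)"
    using assms(1) by (intro card_digit_dominated) simp
  ultimately show ?thesis
    using fin one_in_digit_dominated[OF assms(1), of n k] assms(2)
    by (simp add: Pset_eq card_insert_if insert_absorb)
qed

lemma Pset_subset:
  assumes "p > 0" "n < p ^ (k + 1)" "n \<ge> 2"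
  shows "Pset p n k \<subseteq> {0..<n}"
proof -
  have "m \<le> n" if m: "m \<in> digit_dominated p n k" for m
  proof -
    obtain e where e: "m = (\<Sum>j\<le>k. e j * p ^ j)" "\<forall>j\<le>k. e j \<le> digit p j n"
      using m unfolding digit_dominated_def by blast
    have "m \<le> (\<Sum>j\<le>k. digit p j n * p ^ j)"
      unfolding e(1) using e(2) by (intro sum_mono mult_le_mono1) auto
    then show ?thesis using sum_digits[OF assms(1,2)] by simp
  qed
  then show ?thesis using assms(3) by (auto simp: Pset_eq order_less_le)
qed

text \<open>With full lower digits, only the top digit constrains \<open>m\<close>, and it is
  monotone. Conversely, a deficient lower digit yields a number below \<open>n\<close> that is
  missing from \<open>P\<close>.\<close>

lemma Pset_eq_iff:
  assumes "p > 2" "n \<ge> 4" "p ^ k \<le> n" "n < p ^ (k + 1)"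
  shows "Pset p n k = {0..<n} \<longleftrightarrow> (\<forall>j<k. digit p j n = p - 1)"
proof
  assume all: "\<forall>j<k. digit p j n = p - 1"
  have p0: "p > 0" using assms(1) by simp
  have "m \<in> Pset p n k" if m: "m < n" for m
  proof -
    have "digit p j m \<le> digit p j n" if "j \<le> k" for j
    proof (cases "j = k")
      case True
      have "m div p ^ k < p" "n div p ^ k < p"
        using m assms(4) by (auto simp: less_mult_imp_div_less)
      then show ?thesis using True m by (simp add: digit_def div_le_mono)
    next
      case False
      then have "digit p j n = p - 1" using all that by simp
      moreover have "digit p j m < p" using p0 by (simp add: digit_def)
      ultimately show ?thesis by simp
    qed
    then show ?thesis using m assms(4) p0 by (simp add: Pset_eq digit_dominated_iff)
  qed
  then show "Pset p n k = {0..<n}" using Pset_subset[of p n k] assms by auto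
next
  assume eq: "Pset p n k = {0..<n}"
  have p0: "p > 0" using assms(1) by simp
  show "\<forall>j<k. digit p j n = p - 1"
  proof (rule ccontr)
    assume "\<not> (\<forall>j<k. digit p j n = p - 1)"
    then obtain j where j: "j < k" "digit p j n \<noteq> p - 1" by blast
    have "digit p j n < p" using p0 by (simp add: digit_def)
    with j have d: "digit p j n + 1 < p" by simp
    have all: "digit p i m \<le> digit p i n" if "m < n" "m \<noteq> 1" "i \<le> k" for m i
    proof -
      have "m \<in> Pset p n k" using that eq by simp
      then show ?thesis using that p0 by (simp add: Pset_eq digit_dominated_iff)
    qed
    \<comment> \<open>Exceeds \<open>n\<close> in digit \<open>j\<close> alone, yet stays below
      \<open>p ^ k\<close>.\<close>
    define m where "m = (digit p j n + 1) * p ^ j"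
    have "m < p * p ^ j" unfolding m_def using d p0 by (intro mult_strict_right_mono) auto
    also have "\<dots> = p ^ Suc j" by simp
    also have "\<dots> \<le> p ^ k" using j p0 by (intro power_increasing) auto
    finally have m: "m < n" using assms(3) by simp
    have dm: "digit p j m = digit p j n + 1" using d p0 by (simp add: m_def digit_def)
    show False
    proof (cases "m = 1")
      case False
      then show False using all[OF m False, of j] j dm by simp
    next
      case True
      then have "p ^ j = 1" "digit p j n = 0" unfolding m_def nat_mult_eq_1_iff by simp_all
      then have "j = 0" using assms(1) by simp
      \<comment> \<open>The witness 1 fails since 1 was adjoined to \<open>P\<close>; here
        \<open>n\<close> has lowest digit 0 and the number 2 takes over, being a single digit as
        \<open>p > 2\<close>.\<close>
      have "digit p 0 2 \<le> digit p 0 n" using all[of 2 0] assms(2) by simp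
      moreover have "digit p 0 2 = 2" using assms(1) by (simp add: digit_def)
      ultimately show False using \<open>j = 0\<close> \<open>digit p j n = 0\<close> by simp
    qed
  qed
qed

theorem theorem5p3:
  fixes p n k :: nat
  assumes "prime p" and "odd p" and "n \<ge> 4"
    and "p ^ k \<le> n" and "n < p ^ (k + 1)"
  shows "card (Pset p n k) =
           (if digit p 0 n = 0 then (\<Prod>j\<le>k. digit p j n + 1)
            else (\<Prod>j\<le>k. digit p j n + 1) - 1)
       \<and> (\<forall>i::int. 0 \<le> i \<and> i < int p \<longrightarrow>
            real (cD p i n) =
              (if i = 0 \<or> (\<forall>j<k. digit p j n = p - 1) then
                 (2::real) powi (int n - int (card (Pset p n k))) *
                   real (card {T. T \<subseteq> Pset p n k \<and> [rD p n k T = i] (mod int p)})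
               else
                 (2::real) powi (int n - int (card (Pset p n k)) - 1) *
                   real (card {T. T \<subseteq> Pset p n k \<and>
                     ([rD p n k T = i] (mod int p) \<or> [rD p n k T = - i] (mod int p))})))"
proof -
  let ?P = "Pset p n k" and ?r = "rD p n k"
  let ?A = "\<lambda>i. {T. T \<subseteq> ?P \<and> [?r T = i] (mod int p)}"
  have p2: "p > 2" using assms(1,2) prime_gt_1_nat[of p] by (cases "p = 2") auto
  have p0: "p > 0" using p2 by simp
  have sub: "?P \<subseteq> {0..<n}" using Pset_subset[OF p0 assms(5)] assms(3) by simp
  then have finP: "finite ?P" using finite_subset by blast
  define Q where "Q = {0..<n} - ?P"
  have Q: "finite Q" "?P \<inter> Q = {}" "?P \<union> Q = {0..<n}" using sub by (auto simp: Q_def)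
  have cardQ: "int n - int (card ?P) = int (card Q)"
    using card_Un_disjoint[OF finP Q(1,2)] Q(3) by simp
  have Q_empty: "Q = {} \<longleftrightarrow> (\<forall>j<k. digit p j n = p - 1)"
    using Pset_eq_iff[OF p2 assms(3-5)] sub by (auto simp: Q_def)
  have cD: "cD p i n = card {S. S \<subseteq> ?P \<union> Q \<and> [(-1) ^ card (S - ?P) * ?r (S \<inter> ?P) = i] (mod int p)}" for i
    unfolding Q(3) by (rule cD_eq_card_subsets[OF assms(1,2) _ assms(5)]) (use assms(3) in simp)
  have main: "real (cD p i n) = (if i = 0 \<or> Q = {} then 2 powi int (card Q) * real (card (?A i))
      else 2 powi (int (card Q) - 1) * real (card {T. T \<subseteq> ?P \<and> ([?r T = i] (mod int p) \<or> [?r T = - i] (mod int p))}))"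
    if i: "0 \<le> i" "i < int p" for i
  proof (cases "Q = {}")
    case True
    have "S \<subseteq> ?P \<and> [(-1) ^ card (S - ?P) * ?r (S \<inter> ?P) = i] (mod int p) \<longleftrightarrow>
        S \<subseteq> ?P \<and> [?r S = i] (mod int p)" for S
    proof (cases "S \<subseteq> ?P")
      case True
      then have "S - ?P = {}" "S \<inter> ?P = S" by auto
      then show ?thesis by (simp only: card.empty power_0 mult_1)
    qed simp
    then show ?thesis using cD[of i] True by simp
  next
    case False
    \<comment> \<open>\<open>Q\<close> is nonempty, so the integer exponent
      \<open>card Q - 1\<close> is a natural number.\<close>
    then have c: "int (card Q) - 1 = int (card Q - 1)" "card Q = Suc (card Q - 1)"
      using Q(1) by (auto simp: Suc_le_eq card_gt_0_iff of_nat_diff)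
    have e: "cD p i n = 2 ^ (card Q - 1) * (card (?A i) + card (?A (- i)))"
      unfolding cD by (rule card_signed_residue_subsets[OF finP Q(1,2) False])
    show ?thesis
    proof (cases "i = 0")
      case True
      \<comment> \<open>For \<open>i = 0\<close> the classes of \<open>i\<close> and
        \<open>- i\<close> coincide, and the doubled count restores the exponent
        \<open>card Q\<close>.\<close>
      then have "cD p i n = 2 ^ card Q * card (?A i)" using e by (subst c(2)) simp
      then show ?thesis using True by simp
    next
      case i0: False
      \<comment> \<open>A nonzero residue differs from its negative because \<open>p\<close> is odd;
        hence the two families of sets \<open>T\<close> are disjoint and their sizes add.\<close>
      have "\<not> [i = - i] (mod int p)"
      proof
        assume "[i = - i] (mod int p)"
        then have "int p dvd 2 * i" by (simp add: cong_iff_dvd_diff)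
        moreover have "coprime (int p) 2" using assms(2) by simp
        ultimately have "int p dvd i" by (simp add: coprime_dvd_mult_right_iff)
        then show False using i i0 zdvd_not_zless by auto
      qed
      then have "?A i \<inter> ?A (- i) = {}" by (auto dest: cong_sym cong_trans)
      moreover have "{T. T \<subseteq> ?P \<and> ([?r T = i] (mod int p) \<or> [?r T = - i] (mod int p))} = ?A i \<union> ?A (- i)"
        by auto
      ultimately have "card {T. T \<subseteq> ?P \<and> ([?r T = i] (mod int p) \<or> [?r T = - i] (mod int p))} =
          card (?A i) + card (?A (- i))"
        using finP by (simp add: card_Un_disjoint)
      then show ?thesis using e i0 False by (simp add: c(1))
    qed
  qed
  have "card ?P = (if digit p 0 n = 0 then (\<Prod>j\<le>k. digit p j n + 1) else (\<Prod>j\<le>k. digit p j n + 1) - 1)"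
    using card_Pset[of p n k] p2 assms(3,5) by simp
  then show ?thesis using main unfolding cardQ Q_empty by blast
qed

end
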